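(* Let $L=L^*\ge0$ be a bounded operator on $\mathcal{H}_{\mathrm u}$, and suppose that there is an increasing sequence of finite-rank orthogonal projections $P_N$ on $\mathcal{H}_{\mathrm u}$ such that $P_NL=LP_N$ for all $N$ and $P_N\to I$ strongly in $\mathcal{H}_{\mathrm u}$. Let $C:\mathcal{H}_{\mathrm r}\to\mathcal{H}_{\mathrm u}$ be a compact linear operator and define $$C_N:=P_NC,\qquad K_N(t):=C_N^*e^{-tL}C_N,\qquad K(t):=C^*e^{-tL}C .$$ Let $T>0$. Then $$\delta_N:=\|(I-P_N)C\|\longrightarrow0$$ and $$\|K_N-K\|_{\mathscr K_T(\mathcal{H}_{\mathrm r})}\le2T\|C\|\,\delta_N .$$ Therefore, for any fixed generator $A$ of a strongly continuous semigroup $S_A(t)$ on $\mathcal{H}_{\mathrm r}$ with $\|S_A(t)\|\le Me^{\omega t}$ for $t\ge 0$ ($M\ge1$, $\omega\in\mathbb{R}$), any $F\in L^1(0,T;\mathcal{H}_{\mathrm r})$, and every $x_0\in\mathcal{H}_{\mathrm r}$, the mild solutions $x_N$ of $x_N'=Ax_N-K_N*x_N+F$, $x_N(0)=x_0$, converge in $\mathcal{C}([0,T];\mathcal{H}_{\mathrm r})$ to the mild solution $x$ of $x'=Ax-K*x+F$, $x(0)=x_0$, and the family $(L,C_N)$ is a structure-preserving stable reduction of $(L,C)$ on $[0,T]$. Furthermore, $P_N\mathcal{H}_{\mathrm u}$ is finite-dimensional and invariant under $L$, and if $$L|_{P_N\mathcal{H}_{\mathrm u}}=\sum_{j=1}^{m_N}\lambda_{j,N}Q_{j,N}$$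 is its spectral decomposition, then $$K_N(t)=\sum_{j=1}^{m_N}e^{-\lambda_{j,N}t}C_N^*Q_{j,N}C_N,$$ where every weight $C_N^*Q_{j,N}C_N$ is self-adjoint and non-negative.
   Context: $\mathcal{H}_{\mathrm r}$ and $\mathcal{H}_{\mathrm u}$ are separable real Hilbert spaces; operator norms are written $\|\cdot\|$; $\|K\|_{\mathscr K_T(\mathcal{H}_{\mathrm r})}:=\int_0^T\|K(t)\|\,dt$; $(K*x)(t):=\int_0^tK(t-s)x(s)\,ds$. The mild solution of $x'=Ax-K*x+F$, $x(0)=x_0$ is the function $x\in\mathcal{C}([0,T];\mathcal{H}_{\mathrm r})$ with $x(t)=S_A(t)x_0+\int_0^tS_A(t-s)\{F(s)-(K*x)(s)\}\,ds$. The $Q_{j,N}$ are the orthogonal spectral projections of $L|_{P_N\mathcal{H}_{\mathrm u}}$ on $P_N\mathcal{H}_{\mathrm u}$ and $\lambda_{j,N}$ its eigenvalues; $C_N$ takes values in $P_N\mathcal{H}_{\mathrm u}$. Definition (structure-preserving stable reduction). Let $L$ be bounded self-adjoint non-negative on $\mathcal{H}_{\mathrm u}$, $C:\mathcal{H}_{\mathrm r}\to\mathcal{H}_{\mathrm u}$ bounded, and let $(L_n,C_n)$ be a family of bounded operators $L_n$ on $\mathcal{H}_{\mathrm u}$ and $C_n:\mathcal{H}_{\mathrm r}\to\mathcal{H}_{\mathrm u}$, with kernels $K_n(t)=C_n^*e^{-tL_n}C_n$, $K(t)=C^*e^{-tL}C$. For fixed $A,F,x_0$ let $x_n,x$ be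 the mild solutions of $x_n'=Ax_n-K_n*x_n+F$, $x'=Ax-K*x+F$, $x_n(0)=x(0)=x_0$, and set $q_n(t):=\int_0^te^{-(t-s)L_n}C_nx_n(s)\,ds$, $q(t):=\int_0^te^{-(t-s)L}Cx(s)\,ds$. The family is a structure-preserving stable reduction on $[0,T]$ of $(L,C)$ if: (P1) each $L_n$ is self-adjoint and non-negative, and the feedback is represented by the adjoint pair $C_n^*,C_n$; (P2) $x_n\to x$ in $\mathcal{C}([0,T];\mathcal{H}_{\mathrm r})$ and $q_n\to q$ in $\mathcal{C}([0,T];\mathcal{H}_{\mathrm u})$; (P3) $\frac12\|q_n(T)\|^2+\int_0^T\|L_n^{1/2}q_n(t)\|^2dt\to\frac12\|q(T)\|^2+\int_0^T\|L^{1/2}q(t)\|^2dt$. In the claim, this is applied with $L_N=L$ for all $N$. *)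

theory Defs
  imports "HOL-Analysis.Analysis"
begin

text \<open>
  A separable real Hilbert space is a type of sort
  \<open>{real_inner, banach, second_countable_topology}\<close>; bounded operators are elements of
  \<open>'a \<Rightarrow>\<^sub>L 'b\<close>, whose norm is the operator norm.
\<close>

section \<open>Bounded operators on Hilbert spaces\<close>

definition adj :: "('a::{real_inner,banach} \<Rightarrow>\<^sub>L 'b::{real_inner,banach}) \<Rightarrow> ('b \<Rightarrow>\<^sub>L 'a)" where
  "adj A = Blinfun (adjoint (blinfun_apply A))"

definition selfadjoint :: "('a::{real_inner,banach} \<Rightarrow>\<^sub>L 'a) \<Rightarrow> bool" where
  "selfadjoint A \<longleftrightarrow> adj A = A"

definition nonneg_op :: "('a::{real_inner,banach} \<Rightarrow>\<^sub>L 'a) \<Rightarrow> bool" where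
  "nonneg_op A \<longleftrightarrow> (\<forall>x. 0 \<le> blinfun_apply A x \<bullet> x)"

definition sqrt_op :: "('a::{real_inner,banach} \<Rightarrow>\<^sub>L 'a) \<Rightarrow> ('a \<Rightarrow>\<^sub>L 'a)" where
  "sqrt_op A = (THE R. selfadjoint R \<and> nonneg_op R \<and> R o\<^sub>L R = A)"

text \<open>
  The library's \<open>exp\<close> needs a Banach algebra type with \<open>norm 1 = 1\<close>, which the operator type is
  not (the space may be trivial); hence the power series is written out.
\<close>

definition exp_op :: "('a::banach \<Rightarrow>\<^sub>L 'a) \<Rightarrow> ('a \<Rightarrow>\<^sub>L 'a)" where
  "exp_op A = (\<Sum>n. (1 / fact n) *\<^sub>R (((o\<^sub>L) A ^^ n) id_blinfun))"

definition compact_op :: "('a::real_normed_vector \<Rightarrow>\<^sub>L 'b::real_normed_vector) \<Rightarrow> bool" where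
  "compact_op A \<longleftrightarrow> (\<forall>B. bounded B \<longrightarrow> compact (closure (blinfun_apply A ` B)))"

definition orth_projection :: "('a::{real_inner,banach} \<Rightarrow>\<^sub>L 'a) \<Rightarrow> bool" where
  "orth_projection P \<longleftrightarrow> P o\<^sub>L P = P \<and> selfadjoint P"

definition finite_dim_subspace :: "'a::real_vector set \<Rightarrow> bool" where
  "finite_dim_subspace V \<longleftrightarrow> (\<exists>B. finite B \<and> V = span B)"

section \<open>Spectral decomposition on an invariant subspace\<close>

definition eigenspace_on :: "('a::real_normed_vector \<Rightarrow>\<^sub>L 'a) \<Rightarrow> 'a set \<Rightarrow> real \<Rightarrow> 'a set" where
  "eigenspace_on L V c = {v \<in> V. blinfun_apply L v = c *\<^sub>R v}"

definition eigenvalues_on :: "('a::real_normed_vector \<Rightarrow>\<^sub>L 'a) \<Rightarrow> 'a set \<Rightarrow> real set" where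
  "eigenvalues_on L V = {c. \<exists>v \<in> eigenspace_on L V c. v \<noteq> 0}"

text \<open>
  The numbers \<open>ev 1, \<dots>, ev m\<close> list the distinct eigenvalues of the restriction of \<open>L\<close> to \<open>V\<close>.
  A spectral projection of this restriction is an operator on \<open>V\<close> only; it is identified
  with its extension by zero to the orthogonal complement of \<open>V\<close>, that is, with the orthogonal
  projection of the whole space onto the eigenspace.
\<close>

definition spectral_decomposition_on ::
  "('a::{real_inner,banach} \<Rightarrow>\<^sub>L 'a) \<Rightarrow> 'a set \<Rightarrow> nat \<Rightarrow> (nat \<Rightarrow> real) \<Rightarrow> (nat \<Rightarrow> 'a \<Rightarrow>\<^sub>L 'a) \<Rightarrow> bool" where
  "spectral_decomposition_on L V m ev Q \<longleftrightarrow>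
     bij_betw ev {1..m} (eigenvalues_on L V) \<and>
     (\<forall>j\<in>{1..m}. orth_projection (Q j) \<and> range (blinfun_apply (Q j)) = eigenspace_on L V (ev j)) \<and>
     (\<forall>v\<in>V. blinfun_apply L v = (\<Sum>j=1..m. ev j *\<^sub>R blinfun_apply (Q j) v))"

section \<open>Strongly continuous semigroups\<close>

text \<open>Semigroups are only constrained at times \<open>t \<ge> 0\<close>.\<close>

definition C0_semigroup :: "(real \<Rightarrow> 'a::banach \<Rightarrow>\<^sub>L 'a) \<Rightarrow> bool" where
  "C0_semigroup S \<longleftrightarrow>
     S 0 = id_blinfun \<and>
     (\<forall>s\<ge>0. \<forall>t\<ge>0. S (s + t) = S s o\<^sub>L S t) \<and>
     (\<forall>x. continuous_on {0..} (\<lambda>t. blinfun_apply (S t) x))"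

text \<open>
  \<open>A\<close>, with domain \<open>D\<close>, is the (possibly unbounded) infinitesimal generator of \<open>S\<close>;
  the values of \<open>A\<close> outside \<open>D\<close> are irrelevant.
\<close>

definition generator_of :: "'a::banach set \<Rightarrow> ('a \<Rightarrow> 'a) \<Rightarrow> (real \<Rightarrow> 'a \<Rightarrow>\<^sub>L 'a) \<Rightarrow> bool" where
  "generator_of D A S \<longleftrightarrow>
     D = {x. \<exists>y. ((\<lambda>h. (1 / h) *\<^sub>R (blinfun_apply (S h) x - x)) \<longlongrightarrow> y) (at_right 0)} \<and>
     (\<forall>x\<in>D. ((\<lambda>h. (1 / h) *\<^sub>R (blinfun_apply (S h) x - x)) \<longlongrightarrow> A x) (at_right 0))"

section \<open>Memory kernels and mild solutions\<close>

definition memory_kernel ::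
  "('u::{real_inner,banach} \<Rightarrow>\<^sub>L 'u) \<Rightarrow> ('r::{real_inner,banach} \<Rightarrow>\<^sub>L 'u) \<Rightarrow> real \<Rightarrow> 'r \<Rightarrow>\<^sub>L 'r" where
  "memory_kernel L C t = adj C o\<^sub>L exp_op ((- t) *\<^sub>R L) o\<^sub>L C"

definition kernel_norm :: "real \<Rightarrow> (real \<Rightarrow> 'r::real_normed_vector \<Rightarrow>\<^sub>L 'r) \<Rightarrow> real" where
  "kernel_norm T K = (LINT t:{0..T}|lborel. norm (K t))"

definition kernel_conv ::
  "(real \<Rightarrow> 'r::{banach,second_countable_topology} \<Rightarrow>\<^sub>L 'r) \<Rightarrow> (real \<Rightarrow> 'r) \<Rightarrow> real \<Rightarrow> 'r" where
  "kernel_conv K x t = (LINT s:{0..t}|lborel. blinfun_apply (K (t - s)) (x s))"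

text \<open>
  The mild solution of \<open>x' = A x - K * x + F\<close>, \<open>x(0) = x0\<close> depends on \<open>A\<close> only through the
  semigroup \<open>S\<close> it generates.
\<close>

definition is_mild_solution ::
  "real \<Rightarrow> (real \<Rightarrow> 'r::{banach,second_countable_topology} \<Rightarrow>\<^sub>L 'r) \<Rightarrow> (real \<Rightarrow> 'r \<Rightarrow>\<^sub>L 'r) \<Rightarrow>
     (real \<Rightarrow> 'r) \<Rightarrow> 'r \<Rightarrow> (real \<Rightarrow> 'r) \<Rightarrow> bool" where
  "is_mild_solution T S K F x0 x \<longleftrightarrow>
     continuous_on {0..T} x \<and>
     (\<forall>t\<in>{0..T}. x t = blinfun_apply (S t) x0 +
        (LINT s:{0..t}|lborel. blinfun_apply (S (t - s)) (F s - kernel_conv K x s)))"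

text \<open>
  Functions on \<open>[0,T]\<close> are represented by elements of \<open>extensional {0..T}\<close>, so that the mild
  solution is unique as an object of type \<open>real \<Rightarrow> 'r\<close>.
\<close>

definition mild_solution ::
  "real \<Rightarrow> (real \<Rightarrow> 'r::{banach,second_countable_topology} \<Rightarrow>\<^sub>L 'r) \<Rightarrow> (real \<Rightarrow> 'r \<Rightarrow>\<^sub>L 'r) \<Rightarrow>
     (real \<Rightarrow> 'r) \<Rightarrow> 'r \<Rightarrow> real \<Rightarrow> 'r" where
  "mild_solution T S K F x0 =
     (THE x. x \<in> extensional {0..T} \<and> is_mild_solution T S K F x0 x)"

text \<open>Convergence in the Banach space of continuous functions on \<open>[0,T]\<close>.\<close>

definition converges_in_C ::
  "real \<Rightarrow> (nat \<Rightarrow> real \<Rightarrow> 'a::metric_space) \<Rightarrow> (real \<Rightarrow> 'a) \<Rightarrow> bool" where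
  "converges_in_C T f g \<longleftrightarrow>
     (\<forall>n. continuous_on {0..T} (f n)) \<and> continuous_on {0..T} g \<and>
     uniform_limit {0..T} f g sequentially"

section \<open>Structure-preserving stable reductions\<close>

definition hidden_state ::
  "('u::{real_inner,banach,second_countable_topology} \<Rightarrow>\<^sub>L 'u) \<Rightarrow>
     ('r::{real_inner,banach} \<Rightarrow>\<^sub>L 'u) \<Rightarrow> (real \<Rightarrow> 'r) \<Rightarrow> real \<Rightarrow> 'u" where
  "hidden_state L C x t =
     (LINT s:{0..t}|lborel. blinfun_apply (exp_op ((- (t - s)) *\<^sub>R L)) (blinfun_apply C (x s)))"

definition energy_dissipation ::
  "real \<Rightarrow> ('u::{real_inner,banach} \<Rightarrow>\<^sub>L 'u) \<Rightarrow> (real \<Rightarrow> 'u) \<Rightarrow> real" where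
  "energy_dissipation T L q =
     1 / 2 * (norm (q T))\<^sup>2 + (LINT t:{0..T}|lborel. (norm (blinfun_apply (sqrt_op L) (q t)))\<^sup>2)"

text \<open>
  The conditions are relative to fixed data: the semigroup \<open>S\<close>, the forcing \<open>F\<close> and the initial
  value \<open>x0\<close>. The adjoint-pair clause states the defining identity of \<open>adj (Cf n)\<close>, and the
  feedback kernel \<open>memory_kernel (Lf n) (Cf n)\<close> is built from that pair.
\<close>

definition stable_reduction ::
  "real \<Rightarrow> (real \<Rightarrow> 'r::{real_inner,banach,second_countable_topology} \<Rightarrow>\<^sub>L 'r) \<Rightarrow> (real \<Rightarrow> 'r) \<Rightarrow> 'r \<Rightarrow>
     ('u::{real_inner,banach,second_countable_topology} \<Rightarrow>\<^sub>L 'u) \<Rightarrow> ('r \<Rightarrow>\<^sub>L 'u) \<Rightarrow>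
     (nat \<Rightarrow> 'u \<Rightarrow>\<^sub>L 'u) \<Rightarrow> (nat \<Rightarrow> 'r \<Rightarrow>\<^sub>L 'u) \<Rightarrow> bool" where
  "stable_reduction T S F x0 L C Lf Cf \<longleftrightarrow>
     (let xn = (\<lambda>n. mild_solution T S (memory_kernel (Lf n) (Cf n)) F x0);
          x = mild_solution T S (memory_kernel L C) F x0;
          qn = (\<lambda>n. hidden_state (Lf n) (Cf n) (xn n));
          q = hidden_state L C x
      in
        selfadjoint L \<and> nonneg_op L \<and>
        (\<forall>n. selfadjoint (Lf n) \<and> nonneg_op (Lf n)) \<and>
        (\<forall>n h u. blinfun_apply (Cf n) h \<bullet> u = h \<bullet> blinfun_apply (adj (Cf n)) u) \<and>
        converges_in_C T xn x \<and> converges_in_C T qn q \<and>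
        (\<lambda>n. energy_dissipation T (Lf n) (qn n)) \<longlonglongrightarrow> energy_dissipation T L q)"

end

theory Submission
  imports Defs
begin

text \<open>
  Since \<open>P\<^sub>N\<close> commutes with \<open>L\<close>, \<open>K\<^sub>N - K = - C\<^sup>* e\<^sup>-\<^sup>t\<^sup>L (I - P\<^sub>N) C\<close>, and \<open>e\<^sup>-\<^sup>t\<^sup>L\<close> is a contraction
  for \<open>t \<ge> 0\<close>; compactness of \<open>C\<close> upgrades strong to norm convergence of \<open>(I - P\<^sub>N) C\<close>. A mild
  solution solves a linear Volterra equation whose memory term is a contraction in an exponentially
  weighted supremum norm: this gives existence and uniqueness, and stability of the solution under
  perturbations of the kernel. The hidden states are convolutions of the states and inherit their
  convergence. In the spectral formula, \<open>e\<^sup>-\<^sup>t\<^sup>L\<close> acts on the eigenvectors by scalars.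
\<close>

text \<open>The semigroup is only strongly continuous and \<open>F\<close> only integrable, so no
  estimate may use continuity of \<open>S\<close> in operator norm. \<open>strong_family\<close>
  keeps what remains: continuous orbits and a uniform bound on [0,T]. Together these give joint
  continuity in time and vector, hence measurable convolution integrands and continuous
  convolutions.

  Convergence of the states rests on uniformity in N. All couplings \<open>P N C\<close> have norm
  at most |C|, so all reduced kernels share the bound |C|^2, and one exponential rate and one
  stability constant serve every N.

  Several objects (\<open>adj\<close>, \<open>mild_solution\<close>) are defined by choice or
  description. They carry information only once existence, and where needed uniqueness, has been
  proved.\<close>

section \<open>Riesz representation, adjoints and orthogonal projections\<close>

text \<open>The representing vector minimises \<open>J x = |x|^2 - 2 f x\<close>, which equals |x -
  w|^2 - |w|^2 for the vector w sought. Boundedness of \<open>f\<close> bounds \<open>J\<close>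
  below, the parallelogram law makes a minimising sequence Cauchy, and the first variation vanishes
  at its limit.\<close>

lemma riesz_representation:
  fixes f :: "'a::{real_inner,banach} \<Rightarrow> real"
  assumes "bounded_linear f"
  shows "\<exists>w. \<forall>x. f x = w \<bullet> x"
proof -
  interpret bounded_linear f by fact
  define J where "J x = (norm x)\<^sup>2 - 2 * f x" for x
  obtain K where K: "norm (f x) \<le> norm x * K" for x
    using bounded by blast
  have J_ge: "- K\<^sup>2 \<le> J x" for x
  proof -
    have "f x \<le> norm x * K" using K[of x] by simp
    moreover have "0 \<le> (norm x - K)\<^sup>2" by simp
    ultimately show ?thesis unfolding J_def by (simp add: power2_diff)
  qed
  have bdd: "bdd_below (range J)" using J_ge by (intro bdd_belowI[of _ "- K\<^sup>2"]) auto
  define m where "m = Inf (range J)"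
  have m_le: "m \<le> J x" for x
    unfolding m_def by (rule cInf_lower[OF _ bdd]) simp
  have "\<exists>x. J x < m + 1 / real (Suc n)" for n
  proof -
    have "m < m + 1 / real (Suc n)" by simp
    then show ?thesis
      unfolding m_def using cInf_lessD[of "range J" "Inf (range J) + 1 / real (Suc n)"] by auto
  qed
  then obtain X where X: "J (X n) < m + 1 / real (Suc n)" for n by metis
  \<comment> \<open>The linear part of \<open>J\<close> cancels, since the midpoint enters with
    weight 4; what is left is the parallelogram law.\<close>
  have par: "(norm (x - y))\<^sup>2 = 2 * J x + 2 * J y - 4 * J ((1/2) *\<^sub>R (x + y))" for x y
    unfolding J_def power2_norm_eq_inner
    by (simp add: scaleR add algebra_simps inner_commute)
  have X_dist: "(norm (X i - X j))\<^sup>2 \<le> 2 / real (Suc i) + 2 / real (Suc j)" for i j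
    using par[of "X i" "X j"] X[of i] X[of j] m_le[of "(1/2) *\<^sub>R (X i + X j)"] by simp
  have "Cauchy X"
  proof (rule CauchyI)
    fix e :: real assume e: "0 < e"
    obtain N where N: "4 / e\<^sup>2 < real N" using reals_Archimedean2 by blast
    have "norm (X i - X j) < e" if "i \<ge> N" "j \<ge> N" for i j
    proof -
      have Npos: "real N > 0" using N e by (smt (verit) divide_pos_pos zero_less_power)
      have "2 / real (Suc i) \<le> 2 / real N" "2 / real (Suc j) \<le> 2 / real N"
        using that Npos by (auto intro!: divide_left_mono)
      then have "(norm (X i - X j))\<^sup>2 \<le> 4 / real N" using X_dist[of i j] by simp
      also have "\<dots> < e\<^sup>2" using N Npos e by (simp add: field_simps)
      finally show ?thesis using e by (simp add: power2_less_imp_less)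
    qed
    then show "\<exists>N. \<forall>i\<ge>N. \<forall>j\<ge>N. norm (X i - X j) < e" by blast
  qed
  then obtain w where w: "X \<longlonglongrightarrow> w" using Cauchy_convergent convergent_def by blast
  have "(\<lambda>n. J (X n)) \<longlonglongrightarrow> J w"
    unfolding J_def by (intro tendsto_intros tendsto w)
  moreover have "(\<lambda>n. m + 1 / real (Suc n)) \<longlonglongrightarrow> m + 0"
    by (intro tendsto_intros LIMSEQ_Suc[OF lim_1_over_n])
  ultimately have Jw: "J w \<le> m"
    using X by (intro LIMSEQ_le[of "\<lambda>n. J (X n)" "J w" "\<lambda>n. m + 1 / real (Suc n)" m])
      (auto intro: less_imp_le)
  have "f x = w \<bullet> x" for x
  proof -
    define d where "d = w \<bullet> x - f x"
    \<comment> \<open>\<open>t\<close> minimises \<open>t^2 k + 2 t d\<close>, with minimum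
      \<open>- d^2 / k\<close>. The extra 1 in \<open>k\<close> keeps the division sound for
      \<open>x = 0\<close>.\<close>
    define k where "k = (norm x)\<^sup>2 + 1"
    define t where "t = - d / k"
    have k: "k > 0" unfolding k_def by (simp add: add_nonneg_pos)
    have "J w \<le> J (w + t *\<^sub>R x)" using Jw m_le order_trans by blast
    then have "0 \<le> t\<^sup>2 * (norm x)\<^sup>2 + 2 * t * d"
      unfolding J_def power2_norm_eq_inner d_def
      by (simp add: add scaleR algebra_simps inner_commute power2_eq_square)
    also have "\<dots> \<le> t\<^sup>2 * k + 2 * t * d" unfolding k_def by (simp add: algebra_simps)
    also have "\<dots> = - d\<^sup>2 / k" using k unfolding t_def by (simp add: field_simps power2_eq_square)
    finally have "d\<^sup>2 \<le> 0" using k by (simp add: field_simps)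
    then show ?thesis unfolding d_def by simp
  qed
  then show ?thesis by blast
qed

text \<open>\<open>adj\<close> combines a choice (\<open>adjoint\<close>) with a coercion
  (\<open>Blinfun\<close>), so its properties depend on the existence of a bounded adjoint. Riesz
  supplies the values one \<open>y\<close> at a time; linearity follows from uniqueness of the
  representing vector, and the bound from testing with \<open>x = g y\<close> and cancelling a
  factor |g y|.\<close>

lemma fixes A :: "'a::{real_inner,banach} \<Rightarrow>\<^sub>L 'b::{real_inner,banach}"
  shows adj_works: "blinfun_apply A x \<bullet> y = x \<bullet> blinfun_apply (adj A) y"
  and norm_adj_le: "norm (adj A) \<le> norm A"
proof -
  have "\<exists>w. \<forall>x. blinfun_apply A x \<bullet> y = w \<bullet> x" for y
    by (rule riesz_representation)
      (auto intro!: bounded_linear_compose[OF bounded_linear_inner_left blinfun.bounded_linear_right])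
  then obtain g where g: "blinfun_apply A x \<bullet> y = g y \<bullet> x" for x y by metis
  have eqI: "u = v" if "\<And>x. u \<bullet> x = v \<bullet> x" for u v :: 'a
  proof -
    have "(u - v) \<bullet> (u - v) = 0" using that[of "u - v"] by (simp add: inner_diff_left)
    then show ?thesis by simp
  qed
  have bnd: "norm (g y) \<le> norm A * norm y" for y
  proof -
    have "norm (g y) * norm (g y) = blinfun_apply A (g y) \<bullet> y"
      using g[of "g y" y] by (simp add: power2_norm_eq_inner flip: power2_eq_square)
    also have "\<dots> \<le> norm (blinfun_apply A (g y)) * norm y" by (rule norm_cauchy_schwarz)
    also have "\<dots> \<le> (norm A * norm (g y)) * norm y"
      by (intro mult_right_mono norm_blinfun) simp
    finally have "norm (g y) * norm (g y) \<le> norm (g y) * (norm A * norm y)"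
      by (simp add: mult_ac)
    then show ?thesis
      by (cases "norm (g y) = 0") (auto simp: mult_le_cancel_left)
  qed
  have bl: "bounded_linear g"
  proof (rule bounded_linear_intro)
    show "g (x + y) = g x + g y" for x y
      by (rule eqI) (simp flip: g add: inner_add_left inner_add_right)
    show "g (r *\<^sub>R x) = r *\<^sub>R g x" for r x
      by (rule eqI) (simp flip: g)
    show "norm (g x) \<le> norm x * norm A" for x using bnd[of x] by (simp add: mult.commute)
  qed
  have "adjoint (blinfun_apply A) = g"
    by (rule adjoint_unique) (metis g inner_commute)
  then have adj: "blinfun_apply (adj A) = g"
    unfolding adj_def by (simp add: bounded_linear_Blinfun_apply[OF bl])
  show "blinfun_apply A x \<bullet> y = x \<bullet> blinfun_apply (adj A) y"
    by (metis adj g inner_commute)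
  show "norm (adj A) \<le> norm A"
    by (rule norm_blinfun_bound) (auto simp: adj bnd)
qed

lemma adj_eqI:
  assumes "\<And>x y. blinfun_apply A x \<bullet> y = x \<bullet> blinfun_apply B y"
  shows "adj A = B"
  unfolding adj_def using adjoint_unique[of "blinfun_apply A" "blinfun_apply B"] assms
  by (simp add: blinfun_apply_inverse)

lemma adj_compose: "adj (A o\<^sub>L B) = adj B o\<^sub>L adj A"
  by (rule adj_eqI) (simp add: adj_works)

lemma selfadjoint_inner:
  "selfadjoint A \<Longrightarrow> blinfun_apply A x \<bullet> y = x \<bullet> blinfun_apply A y"
  using adj_works[of A x y] by (simp add: selfadjoint_def)

lemma orth_projection_apply_range:
  "orth_projection P \<Longrightarrow> v \<in> range (blinfun_apply P) \<Longrightarrow> blinfun_apply P v = v"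
  unfolding orth_projection_def by (metis blinfun_apply_blinfun_compose rangeE)

lemma orth_projection_inner_self:
  assumes "orth_projection P"
  shows "blinfun_apply P x \<bullet> x = (norm (blinfun_apply P x))\<^sup>2"
  using selfadjoint_inner[of P "blinfun_apply P x" x] orth_projection_apply_range[OF assms, of "blinfun_apply P x"]
    assms by (simp add: orth_projection_def power2_norm_eq_inner)

lemma orth_projection_norm_le:
  assumes "orth_projection P"
  shows "norm (blinfun_apply P x) \<le> norm x"
proof -
  have "norm (blinfun_apply P x) * norm (blinfun_apply P x) \<le> norm (blinfun_apply P x) * norm x"
    using orth_projection_inner_self[OF assms, of x] norm_cauchy_schwarz[of "blinfun_apply P x" x]
    by (simp add: power2_eq_square)
  then show ?thesis by (cases "norm (blinfun_apply P x) = 0") (auto simp: mult_le_cancel_left)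
qed

section \<open>The operator exponential\<close>

lemma norm_op_power_le:
  fixes A :: "'a::real_normed_vector \<Rightarrow>\<^sub>L 'a"
  shows "norm ((((o\<^sub>L) A) ^^ n) id_blinfun) \<le> norm A ^ n"
proof (induction n)
  case 0
  show ?case by (simp add: norm_blinfun_id_le)
next
  case (Suc n)
  show ?case
    using order_trans[OF norm_blinfun_compose mult_left_mono[OF Suc norm_ge_zero]] by simp
qed

lemma op_power_scaleR:
  fixes A :: "'a::real_normed_vector \<Rightarrow>\<^sub>L 'a"
  shows "(((o\<^sub>L) (t *\<^sub>R A)) ^^ n) id_blinfun = t ^ n *\<^sub>R ((((o\<^sub>L) A) ^^ n) id_blinfun)"
  by (induction n) (auto intro!: blinfun_eqI simp: blinfun.scaleR_left blinfun.scaleR_right)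

text \<open>Two instances matter: \<open>B\<close> a projection commuting with \<open>A\<close>, and
  \<open>B = A\<close>, which moves a factor \<open>A\<close> of a power from the left to the
  right.\<close>

lemma op_power_commute:
  fixes A :: "'a::real_normed_vector \<Rightarrow>\<^sub>L 'a"
  shows "B o\<^sub>L A = A o\<^sub>L B \<Longrightarrow>
    B o\<^sub>L ((((o\<^sub>L) A) ^^ n) id_blinfun) = ((((o\<^sub>L) A) ^^ n) id_blinfun) o\<^sub>L B"
proof (induction n)
  case 0
  show ?case by (auto intro!: blinfun_eqI)
next
  case (Suc n)
  show ?case
  proof (rule blinfun_eqI)
    fix i
    have "blinfun_apply B (blinfun_apply A v) = blinfun_apply A (blinfun_apply B v)" for v
      using Suc.prems by (metis blinfun_apply_blinfun_compose)
    moreover have "blinfun_apply B (blinfun_apply ((((o\<^sub>L) A) ^^ n) id_blinfun) v)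
        = blinfun_apply ((((o\<^sub>L) A) ^^ n) id_blinfun) (blinfun_apply B v)" for v
      using Suc by (metis blinfun_apply_blinfun_compose)
    ultimately show "blinfun_apply (B o\<^sub>L ((((o\<^sub>L) A) ^^ Suc n) id_blinfun)) i
        = blinfun_apply ((((o\<^sub>L) A) ^^ Suc n) id_blinfun o\<^sub>L B) i" by simp
  qed
qed

text \<open>Pulling the scalar out gives a power series in \<open>t\<close> with fixed operator
  coefficients, the form in which it can be differentiated. The majorant is the scalar series of exp
  (|t| |A|).\<close>

lemma exp_op_sums:
  "(\<lambda>n. (t ^ n / fact n) *\<^sub>R ((((o\<^sub>L) A) ^^ n) id_blinfun)) sums exp_op (t *\<^sub>R A)"
proof -
  have "summable (\<lambda>n. (t ^ n / fact n) *\<^sub>R ((((o\<^sub>L) A) ^^ n) id_blinfun))"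
  proof (rule summable_comparison_test)
    show "summable (\<lambda>n. (\<bar>t\<bar> * norm A) ^ n / fact n)"
      using summable_exp[of "\<bar>t\<bar> * norm A"] by (simp add: field_simps)
    show "\<exists>N. \<forall>n\<ge>N. norm ((t ^ n / fact n) *\<^sub>R ((((o\<^sub>L) A) ^^ n) id_blinfun))
        \<le> (\<bar>t\<bar> * norm A) ^ n / fact n"
      by (auto simp: power_mult_distrib power_abs intro!: divide_right_mono mult_left_mono norm_op_power_le)
  qed
  then show ?thesis
    unfolding exp_op_def by (simp add: op_power_scaleR summable_sums)
qed

lemma exp_op_commute:
  assumes "B o\<^sub>L A = A o\<^sub>L B"
  shows "B o\<^sub>L exp_op (t *\<^sub>R A) = exp_op (t *\<^sub>R A) o\<^sub>L B"
proof (rule sums_unique2)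
  show "(\<lambda>n. B o\<^sub>L (t ^ n / fact n) *\<^sub>R ((((o\<^sub>L) A) ^^ n) id_blinfun)) sums (B o\<^sub>L exp_op (t *\<^sub>R A))"
    by (rule bounded_linear.sums[OF bounded_bilinear.bounded_linear_right[OF bounded_bilinear_blinfun_compose] exp_op_sums])
  have "B o\<^sub>L (t ^ n / fact n) *\<^sub>R ((((o\<^sub>L) A) ^^ n) id_blinfun)
    = (t ^ n / fact n) *\<^sub>R ((((o\<^sub>L) A) ^^ n) id_blinfun) o\<^sub>L B" for n
    using op_power_commute[OF assms, of n]
    by (simp add: bounded_bilinear.scaleR_left[OF bounded_bilinear_blinfun_compose]
        bounded_bilinear.scaleR_right[OF bounded_bilinear_blinfun_compose])
  then show "(\<lambda>n. B o\<^sub>L (t ^ n / fact n) *\<^sub>R ((((o\<^sub>L) A) ^^ n) id_blinfun)) sums (exp_op (t *\<^sub>R A) o\<^sub>L B)"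
    using bounded_linear.sums[OF bounded_bilinear.bounded_linear_left[OF bounded_bilinear_blinfun_compose] exp_op_sums, of t A B]
    by simp
qed

lemma exp_op_eigenvector:
  assumes "blinfun_apply A v = c *\<^sub>R v"
  shows "blinfun_apply (exp_op (t *\<^sub>R A)) v = exp (t * c) *\<^sub>R v"
proof (rule sums_unique2)
  have pow: "blinfun_apply ((((o\<^sub>L) A) ^^ n) id_blinfun) v = c ^ n *\<^sub>R v" for n
    by (induction n) (auto simp: blinfun.scaleR_right assms)
  show "(\<lambda>n. blinfun_apply ((t ^ n / fact n) *\<^sub>R ((((o\<^sub>L) A) ^^ n) id_blinfun)) v)
      sums blinfun_apply (exp_op (t *\<^sub>R A)) v"
    by (rule bounded_linear.sums[OF blinfun.bounded_linear_left exp_op_sums])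
  have "(\<lambda>n. ((t * c) ^ n /\<^sub>R fact n) *\<^sub>R v) sums (exp (t * c) *\<^sub>R v)"
    by (rule bounded_linear.sums[OF bounded_linear_scaleR_left exp_converges])
  then show "(\<lambda>n. blinfun_apply ((t ^ n / fact n) *\<^sub>R ((((o\<^sub>L) A) ^^ n) id_blinfun)) v)
      sums (exp (t * c) *\<^sub>R v)"
    by (simp add: blinfun.scaleR_left pow power_mult_distrib field_simps)
qed

text \<open>Termwise differentiation: the differentiated series is uniformly dominated on a ball
  whose radius |t| + 1 makes \<open>t\<close> an interior point.\<close>

lemma exp_op_has_vector_derivative:
  fixes A :: "'a::banach \<Rightarrow>\<^sub>L 'a"
  shows "((\<lambda>t. exp_op (t *\<^sub>R A)) has_vector_derivative (exp_op (t *\<^sub>R A) o\<^sub>L A)) (at t)"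
proof -
  define R where "R = \<bar>t\<bar> + 1"
  define S where "S = ball (0::real) R"
  have tS: "t \<in> S" by (simp add: S_def R_def)
  define p where "p n = (((o\<^sub>L) A) ^^ n) id_blinfun" for n
  define f where "f n s = (s ^ n / fact n) *\<^sub>R p n" for n and s :: real
  \<comment> \<open>\<open>d 0\<close> vanishes through the factor \<open>real 0\<close>, so the
    truncated exponent \<open>0 - 1\<close> is harmless and the series may be shifted by
    one.\<close>
  define d where "d n s = (real n * s ^ (n - 1) / fact n) *\<^sub>R p n" for n and s :: real
  have d_Suc: "d (Suc n) s = f n s o\<^sub>L A" for n s
  proof -
    have "p (Suc n) = p n o\<^sub>L A"
      using op_power_commute[of A A n] by (simp add: p_def)
    moreover have "real (Suc n) * s ^ n / fact (Suc n) = s ^ n / fact n"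
      by (simp del: of_nat_Suc)
    ultimately show ?thesis
      by (simp add: d_def f_def bounded_bilinear.scaleR_left[OF bounded_bilinear_blinfun_compose]
          del: fact_Suc)
  qed
  have d_sums: "(\<lambda>n. d n s) sums (exp_op (s *\<^sub>R A) o\<^sub>L A)" for s
  proof -
    have "(\<lambda>n. f n s o\<^sub>L A) sums (exp_op (s *\<^sub>R A) o\<^sub>L A)"
      unfolding f_def p_def
      by (rule bounded_linear.sums[OF bounded_bilinear.bounded_linear_left[OF bounded_bilinear_blinfun_compose] exp_op_sums])
    then have "(\<lambda>n. d (Suc n) s) sums (exp_op (s *\<^sub>R A) o\<^sub>L A)" by (simp add: d_Suc)
    then show ?thesis using sums_Suc_iff[of "\<lambda>n. d n s"] by (simp add: d_def)
  qed
  \<comment> \<open>These are the derivatives in \<open>R\<close> of the terms of exp (R |A|); after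
    the index shift they are |A| times that series.\<close>
  define M where "M n = (real n * R ^ (n - 1) / fact n) * norm A ^ n" for n
  have "summable (\<lambda>n. M (Suc n))"
  proof -
    have "M (Suc n) = norm A * ((R * norm A) ^ n /\<^sub>R fact n)" for n
    proof -
      have "real (Suc n) * R ^ n / fact (Suc n) = R ^ n / fact n" by (simp del: of_nat_Suc)
      then have "M (Suc n) = R ^ n / fact n * norm A ^ Suc n" unfolding M_def by (simp only: diff_Suc_1)
      then show ?thesis by (simp add: power_mult_distrib divide_inverse)
    qed
    then show ?thesis using summable_exp_generic[of "R * norm A"] by (simp add: summable_mult)
  qed
  then have M: "summable M" using summable_Suc_iff by blast
  have "uniform_limit S (\<lambda>n s. \<Sum>i<n. d i s) (\<lambda>s. suminf (\<lambda>i. d i s)) sequentially"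
  proof (rule Weierstrass_m_test[OF _ M])
    fix n s assume "s \<in> S"
    then have "\<bar>s\<bar> \<le> R" by (simp add: S_def)
    then have "\<bar>s\<bar> ^ (n - 1) \<le> R ^ (n - 1)" by (intro power_mono) auto
    then show "norm (d n s) \<le> M n"
      unfolding d_def M_def p_def using norm_op_power_le[of n A] \<open>\<bar>s\<bar> \<le> R\<close>
      by (auto simp: power_abs abs_mult intro!: mult_mono divide_right_mono)
  qed
  then have ul: "uniform_limit S (\<lambda>n s. \<Sum>i<n. d i s) (\<lambda>s. exp_op (s *\<^sub>R A) o\<^sub>L A) sequentially"
    using d_sums sums_unique by (metis (no_types, lifting) ext)
  have "\<exists>g. \<forall>s\<in>S. (\<lambda>n. f n s) sums g s \<and>
    (g has_derivative (\<lambda>h. h *\<^sub>R (exp_op (s *\<^sub>R A) o\<^sub>L A))) (at s within S)"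
  proof (rule has_derivative_series[where f' = "\<lambda>n s h. h *\<^sub>R d n s", OF _ _ _ tS])
    show "convex S" by (simp add: S_def)
    show "(f n has_derivative (\<lambda>h. h *\<^sub>R d n s)) (at s within S)" for n s
      unfolding f_def d_def
      by (auto intro!: derivative_eq_intros simp: field_simps)
    show "(\<lambda>n. f n t) sums exp_op (t *\<^sub>R A)"
      unfolding f_def p_def by (rule exp_op_sums)
    fix e :: real assume "e > 0"
    from uniform_limitD[OF ul this]
    show "\<forall>\<^sub>F n in sequentially. \<forall>s\<in>S. \<forall>h. norm ((\<Sum>i<n. h *\<^sub>R d i s) - h *\<^sub>R (exp_op (s *\<^sub>R A) o\<^sub>L A))
        \<le> e * norm h"
    proof eventually_elim
      case (elim n)
      have "norm ((\<Sum>i<n. h *\<^sub>R d i s) - h *\<^sub>R (exp_op (s *\<^sub>R A) o\<^sub>L A))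
        = \<bar>h\<bar> * dist (\<Sum>i<n. d i s) (exp_op (s *\<^sub>R A) o\<^sub>L A)" for s h
        unfolding dist_norm by (simp flip: scaleR_sum_right scaleR_diff_right)
      moreover have "\<bar>h\<bar> * dist (\<Sum>i<n. d i s) (exp_op (s *\<^sub>R A) o\<^sub>L A) \<le> e * norm h"
        if "s \<in> S" for s h
      proof -
        have "dist (\<Sum>i<n. d i s) (exp_op (s *\<^sub>R A) o\<^sub>L A) \<le> e"
          using elim that by (simp add: less_imp_le)
        from mult_right_mono[OF this, of "\<bar>h\<bar>"] show ?thesis by (simp add: mult.commute)
      qed
      ultimately show ?case by simp
    qed
  qed
  then obtain g where g: "\<And>s. s \<in> S \<Longrightarrow> (\<lambda>n. f n s) sums g s"
    "\<And>s. s \<in> S \<Longrightarrow> (g has_derivative (\<lambda>h. h *\<^sub>R (exp_op (s *\<^sub>R A) o\<^sub>L A))) (at s within S)"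
    by blast
  have eq: "exp_op (s *\<^sub>R A) = g s" if "s \<in> S" for s
    using g(1)[OF that] exp_op_sums[of s A] sums_unique2 unfolding f_def p_def by blast
  have "(g has_vector_derivative (exp_op (t *\<^sub>R A) o\<^sub>L A)) (at t within S)"
    unfolding has_vector_derivative_def by (rule g(2)[OF tS])
  then have "(g has_vector_derivative (exp_op (t *\<^sub>R A) o\<^sub>L A)) (at t)"
    using at_within_open[OF tS] by (simp add: S_def)
  then show ?thesis
    by (rule has_vector_derivative_transform_within_open[of _ _ _ S]) (use tS eq in \<open>auto simp: S_def\<close>)
qed

lemma continuous_on_exp_op: "continuous_on X (\<lambda>t. exp_op ((- t) *\<^sub>R A))"
proof -
  have "continuous_on UNIV (\<lambda>t. exp_op (t *\<^sub>R A))"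
    by (intro continuous_at_imp_continuous_on ballI
        has_vector_derivative_continuous[OF exp_op_has_vector_derivative])
  from continuous_on_compose2[OF this, of X uminus] show ?thesis
    by (simp add: continuous_on_minus)
qed

text \<open>Every vector is an eigenvector of the zero operator, with eigenvalue 0.\<close>

lemma exp_op_zero: "exp_op 0 = id_blinfun"
proof (rule blinfun_eqI)
  show "blinfun_apply (exp_op 0) v = blinfun_apply id_blinfun v" for v
    using exp_op_eigenvector[of 0 v 0 0] by simp
qed

text \<open>The squared norm of an orbit is nonincreasing, since its derivative is
  \<open>- 2 * (L v \<bullet> v)\<close> at the current state \<open>v\<close>.\<close>

lemma norm_exp_op_le_1:
  assumes "nonneg_op L" and "0 \<le> t"
  shows "norm (exp_op ((- t) *\<^sub>R L)) \<le> 1"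
proof (rule norm_blinfun_bound)
  fix u
  define v where "v s = blinfun_apply (exp_op ((- s) *\<^sub>R L)) u" for s
  have dv: "(v has_vector_derivative - blinfun_apply L (v s)) (at s)" for s
  proof -
    have "(uminus has_vector_derivative (-1)) (at s)"
      by (auto intro!: derivative_eq_intros)
    then have "((\<lambda>s. exp_op ((- s) *\<^sub>R L)) has_vector_derivative
        (-1) *\<^sub>R (exp_op ((- s) *\<^sub>R L) o\<^sub>L L)) (at s)"
      using vector_diff_chain_at[of uminus "-1" s "\<lambda>t. exp_op (t *\<^sub>R L)",
          OF _ exp_op_has_vector_derivative]
      by (simp add: o_def)
    from bounded_linear.has_vector_derivative[OF blinfun.bounded_linear_left this, of u]
    \<comment> \<open>The chain rule leaves \<open>L\<close> to the right of the exponential, acting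
      on \<open>u\<close>; commuting the two makes it act on the current state
      \<open>v s\<close>.\<close>
    show ?thesis
      unfolding v_def using exp_op_commute[of L L "- s"]
      by (simp add: blinfun.minus_left flip: blinfun_apply_blinfun_compose)
  qed
  have "((\<lambda>s. v s \<bullet> v s) has_real_derivative - 2 * (blinfun_apply L (v s) \<bullet> v s)) (at s)" for s
    using has_derivative_inner[OF dv[of s, unfolded has_vector_derivative_def]
        dv[of s, unfolded has_vector_derivative_def]]
    unfolding has_field_derivative_def
    by (rule has_derivative_eq_rhs) (auto simp: inner_commute algebra_simps)
  then have "v t \<bullet> v t \<le> v 0 \<bullet> v 0"
    using assms unfolding nonneg_op_def
    by (intro DERIV_nonpos_imp_nonincreasing[OF assms(2)]) (metis mult_minus_left neg_le_0_iff_le zero_le_mult_iff zero_le_numeral)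
  then show "norm (blinfun_apply (exp_op ((- t) *\<^sub>R L)) u) \<le> 1 * norm u"
    by (simp add: v_def exp_op_zero norm_eq_sqrt_inner)
qed simp

section \<open>Convolution with a strongly continuous family\<close>

text \<open>One interface for a semigroup, which is continuous only orbitwise, and for the
  norm-continuous kernels. The bound is explicit because it enters the exponential rate. Values
  outside [0,T] are unconstrained, which is why time arguments get clamped.\<close>

definition strong_family ::
  "real \<Rightarrow> real \<Rightarrow> (real \<Rightarrow> 'a::real_normed_vector \<Rightarrow>\<^sub>L 'b::real_normed_vector) \<Rightarrow> bool" where
  "strong_family T B G \<longleftrightarrow>
     (\<forall>v. continuous_on {0..T} (\<lambda>t. blinfun_apply (G t) v)) \<and> (\<forall>t\<in>{0..T}. norm (G t) \<le> B)"

lemma clamp_real: "a \<le> b \<Longrightarrow> clamp a b x = max a (min b x)" for a b x :: real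
  unfolding clamp_def Basis_real_def by auto

lemma clamp_real_mem: "0 \<le> T \<Longrightarrow> clamp 0 T t \<in> {0..T}" for T t :: real
  by (auto simp: clamp_real)

lemma clamp_real_id: "t \<in> {0..T} \<Longrightarrow> clamp 0 T t = t" for T t :: real
  by (auto simp: clamp_real)

lemma strong_family_nonneg: "strong_family T B G \<Longrightarrow> 0 \<le> T \<Longrightarrow> 0 \<le> B"
  unfolding strong_family_def using norm_ge_zero order_trans by (metis atLeastAtMost_iff order_refl)

lemma strong_family_apply_le:
  "strong_family T B G \<Longrightarrow> t \<in> {0..T} \<Longrightarrow> norm (blinfun_apply (G t) v) \<le> B * norm v"
  unfolding strong_family_def
  by (meson mult_right_mono norm_blinfun norm_ge_zero order_trans)

text \<open>Split \<open>G r v - G r0 v0\<close> into \<open>G r (v - v0)\<close>, small by the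
  uniform bound, and \<open>(G r - G r0) v0\<close>, small by strong continuity. Clamping makes this
  hold on the whole product space, so that Borel measurability can be read off.\<close>

lemma strong_family_clamp_continuous:
  assumes "strong_family T B G" "0 \<le> T"
  shows "continuous_on UNIV (\<lambda>x. blinfun_apply (G (clamp 0 T (fst x))) (snd x))"
proof (rule continuous_at_imp_continuous_on, rule ballI)
  fix x :: "real \<times> 'a"
  define H where "H r = G (clamp 0 T r)" for r
  have H: "norm (blinfun_apply (H r) v) \<le> B * norm v" for r v
    unfolding H_def by (rule strong_family_apply_le[OF assms(1) clamp_real_mem[OF assms(2)]])
  have cont: "isCont (\<lambda>r. blinfun_apply (H r) v) r" for v r
    unfolding H_def using assms
    by (intro clamp_continuous_at) (auto simp: strong_family_def)
  have "((\<lambda>y. B * norm (snd y - snd x)) \<longlongrightarrow> B * norm (snd x - snd x)) (at x)"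
    by (intro tendsto_intros)
  then have lim: "((\<lambda>y. B * norm (snd y - snd x)) \<longlongrightarrow> 0) (at x)" by simp
  have "((\<lambda>y. blinfun_apply (H (fst y)) (snd y - snd x)) \<longlongrightarrow> 0) (at x)"
    by (rule Lim_null_comparison[OF _ lim], rule always_eventually) (use H in blast)
  moreover have "((\<lambda>y. blinfun_apply (H (fst y)) (snd x)) \<longlongrightarrow> blinfun_apply (H (fst x)) (snd x)) (at x)"
    by (rule isCont_tendsto_compose[OF cont]) (intro tendsto_intros)
  ultimately have "((\<lambda>y. blinfun_apply (H (fst y)) (snd y - snd x) + blinfun_apply (H (fst y)) (snd x))
      \<longlongrightarrow> 0 + blinfun_apply (H (fst x)) (snd x)) (at x)"
    by (rule tendsto_add)
  then show "isCont (\<lambda>x. blinfun_apply (G (clamp 0 T (fst x))) (snd x)) x"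
    by (simp add: isCont_def H_def blinfun.diff_right)
qed

lemma strong_family_measurable:
  fixes G :: "real \<Rightarrow> 'a::{real_normed_vector,second_countable_topology} \<Rightarrow>\<^sub>L 'b::real_normed_vector"
  assumes "strong_family T B G" "0 \<le> T" "f \<in> borel_measurable lborel"
  shows "(\<lambda>s. blinfun_apply (G (clamp 0 T (t - s))) (f s)) \<in> borel_measurable lborel"
  by (rule borel_measurable_continuous_Pair[where H = "\<lambda>r v. blinfun_apply (G (clamp 0 T r)) v"])
    (use assms strong_family_clamp_continuous in auto)

text \<open>On the support of the indicator both \<open>t - s\<close> and \<open>s\<close> lie in
  [0,T], so clamping and truncating change nothing there. The right-hand side has the form for which
  measurability on the whole line is available.\<close>

lemma kernel_conv_integrand:
  fixes G :: "real \<Rightarrow> 'a::real_normed_vector \<Rightarrow>\<^sub>L 'b::real_normed_vector"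
  assumes "t \<in> {0..T}"
  shows "indicator {0..t} s *\<^sub>R blinfun_apply (G (t - s)) (f s) =
    indicator {0..t} s *\<^sub>R blinfun_apply (G (clamp 0 T (t - s))) (indicator {0..T} s *\<^sub>R f s)"
proof (cases "s \<in> {0..t}")
  case True
  then have "clamp 0 T (t - s) = t - s" "s \<in> {0..T}" using assms by (auto intro!: clamp_real_id)
  then show ?thesis using True by simp
qed simp

context
  fixes T B :: real and G :: "real \<Rightarrow> 'r::{banach,second_countable_topology} \<Rightarrow>\<^sub>L 'r" and f :: "real \<Rightarrow> 'r"
  assumes G: "strong_family T B G" and f: "set_integrable lborel {0..T} f"
begin

lemma kernel_conv_measurable:
  assumes "t \<in> {0..T}"
  shows "(\<lambda>s. indicator {0..t} s *\<^sub>R blinfun_apply (G (t - s)) (f s)) \<in> borel_measurable lborel"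
proof -
  have meas: "(\<lambda>s. indicator {0..T} s *\<^sub>R f s) \<in> borel_measurable lborel"
    using f unfolding set_integrable_def by (rule borel_measurable_integrable)
  show ?thesis
    unfolding kernel_conv_integrand[OF assms, where G = G and f = f]
    using assms by (intro borel_measurable_scaleR strong_family_measurable[OF G _ meas]) auto
qed

text \<open>The bound does not depend on \<open>t\<close>: one majorant serves integrability at each
  time and dominated convergence as the time varies.\<close>

lemma kernel_conv_integrand_le:
  assumes "t \<in> {0..T}"
  shows "norm (indicator {0..t} s *\<^sub>R blinfun_apply (G (t - s)) (f s))
    \<le> B * norm (indicator {0..T} s *\<^sub>R f s)"
  using assms strong_family_apply_le[OF G, of "t - s" "f s"] strong_family_nonneg[OF G]
  by (auto split: split_indicator)

lemma kernel_conv_dominating: "integrable lborel (\<lambda>s. B * norm (indicator {0..T} s *\<^sub>R f s))"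
  using f unfolding set_integrable_def by (intro integrable_mult_right integrable_norm)

lemma kernel_conv_integrable:
  assumes "t \<in> {0..T}"
  shows "set_integrable lborel {0..t} (\<lambda>s. blinfun_apply (G (t - s)) (f s))"
  unfolding set_integrable_def
  using order_trans[OF kernel_conv_integrand_le[OF assms] abs_ge_self]
  by (intro Bochner_Integration.integrable_bound[OF kernel_conv_dominating kernel_conv_measurable[OF assms]] AE_I2)
    (simp only: real_norm_def)

lemma norm_kernel_conv_le:
  assumes "t \<in> {0..T}"
  shows "norm (kernel_conv G f t) \<le> B * (LINT s:{0..t}|lborel. norm (f s))"
proof -
  have ft: "set_integrable lborel {0..t} (\<lambda>s. norm (f s))"
    using assms by (intro set_integrable_norm set_integrable_subset[OF f]) auto
  have "norm (kernel_conv G f t) \<le> (LINT s:{0..t}|lborel. norm (blinfun_apply (G (t - s)) (f s)))"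
    unfolding kernel_conv_def by (rule set_integral_norm_bound[OF kernel_conv_integrable[OF assms]])
  also have "\<dots> \<le> (LINT s:{0..t}|lborel. B * norm (f s))"
    using assms ft
    by (intro set_integral_mono set_integrable_norm kernel_conv_integrable)
      (auto intro!: strong_family_apply_le[OF G])
  finally show ?thesis by simp
qed

text \<open>Dominated convergence along a sequence of times, which also covers a merely integrable
  \<open>f\<close> such as the forcing.\<close>

lemma continuous_on_kernel_conv: "continuous_on {0..T} (kernel_conv G f)"
proof (rule continuous_on_sequentiallyI)
  fix u a assume u: "\<forall>n. u n \<in> {0..T}" and a: "a \<in> {0..T}" and lim: "u \<longlonglongrightarrow> a"
  define g where "g t s = indicator {0..t} s *\<^sub>R blinfun_apply (G (t - s)) (f s)" for t s
  have gI: "kernel_conv G f t = integral\<^sup>L lborel (g t)" for t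
    by (simp add: kernel_conv_def set_lebesgue_integral_def g_def[abs_def])
  have "(\<lambda>n. integral\<^sup>L lborel (g (u n))) \<longlonglongrightarrow> integral\<^sup>L lborel (g a)"
  proof (rule integral_dominated_convergence[where w = "\<lambda>s. B * norm (indicator {0..T} s *\<^sub>R f s)"])
    show "g a \<in> borel_measurable lborel" "g (u n) \<in> borel_measurable lborel" for n
      unfolding g_def using u a kernel_conv_measurable by blast+
    show "integrable lborel (\<lambda>s. B * norm (indicator {0..T} s *\<^sub>R f s))" by (rule kernel_conv_dominating)
    show "AE s in lborel. norm (g (u n) s) \<le> B * norm (indicator {0..T} s *\<^sub>R f s)" for n
      unfolding g_def using kernel_conv_integrand_le u by blast
    show "AE s in lborel. (\<lambda>n. g (u n) s) \<longlonglongrightarrow> g a s"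
      \<comment> \<open>At \<open>s = a\<close> the indicators of \<open>{0..u n}\<close> may
        oscillate, so this single point is discarded.\<close>
      using AE_lborel_singleton[of a]
    proof eventually_elim
      case (elim s)
      have ind: "(\<lambda>n. indicator {0..u n} s :: real) \<longlonglongrightarrow> indicator {0..a} s"
      proof (cases "s < a")
        case True
        then have "\<forall>\<^sub>F n in sequentially. s < u n" using order_tendstoD(1)[OF lim] by blast
        then show ?thesis
          using True by (intro tendsto_eventually) (auto elim!: eventually_mono split: split_indicator)
      next
        case False
        with elim have "a < s" by simp
        then have "\<forall>\<^sub>F n in sequentially. u n < s" using order_tendstoD(2)[OF lim] by blast
        then show ?thesis
          using \<open>a < s\<close> by (intro tendsto_eventually) (auto elim!: eventually_mono split: split_indicator)
      qed
      let ?v = "indicator {0..T} s *\<^sub>R f s"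
      have "isCont (\<lambda>x. blinfun_apply (G (clamp 0 T (fst x))) (snd x)) (a - s, ?v)"
        using strong_family_clamp_continuous[OF G] a by (auto simp: continuous_on_eq_continuous_at)
      then have "(\<lambda>n. blinfun_apply (G (clamp 0 T (fst (u n - s, ?v)))) (snd (u n - s, ?v)))
        \<longlonglongrightarrow> blinfun_apply (G (clamp 0 T (fst (a - s, ?v)))) (snd (a - s, ?v))"
        by (rule isCont_tendsto_compose) (intro tendsto_intros lim)
      then have "(\<lambda>n. indicator {0..u n} s *\<^sub>R blinfun_apply (G (clamp 0 T (u n - s))) ?v)
        \<longlonglongrightarrow> indicator {0..a} s *\<^sub>R blinfun_apply (G (clamp 0 T (a - s))) ?v"
        by (intro tendsto_scaleR ind) simp
      moreover have "g t s = indicator {0..t} s *\<^sub>R blinfun_apply (G (clamp 0 T (t - s))) ?v"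
        if "t \<in> {0..T}" for t
        unfolding g_def by (rule kernel_conv_integrand[OF that])
      ultimately show ?case using u a by simp
    qed
  qed
  then show "(\<lambda>n. kernel_conv G f (u n)) \<longlonglongrightarrow> kernel_conv G f a"
    by (simp add: gI)
qed

end

lemma kernel_conv_cong:
  assumes "\<And>s. s \<in> {0..t} \<Longrightarrow> f s = g s"
  shows "kernel_conv G f t = kernel_conv G g t"
  unfolding kernel_conv_def by (rule set_lebesgue_integral_cong) (use assms in auto)

lemma kernel_conv_diff:
  fixes G :: "real \<Rightarrow> 'r::{banach,second_countable_topology} \<Rightarrow>\<^sub>L 'r"
  assumes "strong_family T B G" "set_integrable lborel {0..T} f" "set_integrable lborel {0..T} g"
    and "t \<in> {0..T}"
  shows "kernel_conv G (\<lambda>s. f s - g s) t = kernel_conv G f t - kernel_conv G g t"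
  unfolding kernel_conv_def blinfun.diff_right
  by (intro set_integral_diff kernel_conv_integrable[OF assms(1)] assms)

lemma kernel_conv_kernel_diff:
  fixes G :: "real \<Rightarrow> 'r::{banach,second_countable_topology} \<Rightarrow>\<^sub>L 'r"
  assumes "strong_family T B G" "strong_family T B' G'" "set_integrable lborel {0..T} f"
    and "t \<in> {0..T}"
  shows "kernel_conv (\<lambda>s. G s - G' s) f t = kernel_conv G f t - kernel_conv G' f t"
  unfolding kernel_conv_def blinfun.diff_left
  by (intro set_integral_diff kernel_conv_integrable[OF assms(1)] kernel_conv_integrable[OF assms(2)] assms)

section \<open>Weighted and unweighted bounds for convolutions\<close>

lemma set_integral_exp_weight_le:
  fixes m b t :: real
  assumes "0 \<le> m" "0 < b" "0 \<le> t"
  shows "(LINT s:{0..t}|lborel. m * exp (b * s)) \<le> m * exp (b * t) / b"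
proof -
  have "(LINT s:{0..t}|lborel. m * exp (b * s)) = m * exp (b * t) / b - m * exp (b * 0) / b"
    unfolding set_lebesgue_integral_def
    by (rule integral_FTC_atLeastAtMost[where F = "\<lambda>s. m * exp (b * s) / b"])
      (use assms in \<open>auto intro!: derivative_eq_intros continuous_intros
        simp: has_real_derivative_iff_has_vector_derivative[symmetric]\<close>)
  then show ?thesis using assms by simp
qed

lemma kernel_conv_exp_weight:
  fixes G :: "real \<Rightarrow> 'r::{banach,second_countable_topology} \<Rightarrow>\<^sub>L 'r"
  assumes G: "strong_family T B G" and f: "continuous_on {0..T} f" and t: "t \<in> {0..T}"
    and "0 \<le> m" "0 < b" and le: "\<And>s. s \<in> {0..T} \<Longrightarrow> norm (f s) \<le> m * exp (b * s)"
  shows "norm (kernel_conv G f t) \<le> B * m / b * exp (b * t)"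
proof -
  have ft: "set_integrable lborel {0..t} (\<lambda>s. norm (f s))"
    using t by (intro borel_integrable_atLeastAtMost' continuous_intros continuous_on_subset[OF f]) auto
  have "norm (kernel_conv G f t) \<le> B * (LINT s:{0..t}|lborel. norm (f s))"
    by (rule norm_kernel_conv_le[OF G borel_integrable_atLeastAtMost'[OF f] t])
  also have "\<dots> \<le> B * (LINT s:{0..t}|lborel. m * exp (b * s))"
    using t le strong_family_nonneg[OF G]
    by (intro mult_left_mono set_integral_mono ft borel_integrable_atLeastAtMost' continuous_intros) auto
  also have "\<dots> \<le> B * (m * exp (b * t) / b)"
    using assms strong_family_nonneg[OF G] by (intro mult_left_mono set_integral_exp_weight_le) auto
  finally show ?thesis by simp
qed

lemma kernel_conv_const_bound:
  fixes G :: "real \<Rightarrow> 'r::{banach,second_countable_topology} \<Rightarrow>\<^sub>L 'r"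
  assumes G: "strong_family T B G" and f: "continuous_on {0..T} f" and t: "t \<in> {0..T}"
    and le: "\<And>s. s \<in> {0..T} \<Longrightarrow> norm (f s) \<le> m"
  shows "norm (kernel_conv G f t) \<le> B * (T * m)"
proof -
  have ft: "set_integrable lborel {0..t} (\<lambda>s. norm (f s))"
    using t by (intro borel_integrable_atLeastAtMost' continuous_intros continuous_on_subset[OF f]) auto
  have m: "0 \<le> m" using le[OF t] norm_ge_zero order_trans by blast
  have "norm (kernel_conv G f t) \<le> B * (LINT s:{0..t}|lborel. norm (f s))"
    by (rule norm_kernel_conv_le[OF G borel_integrable_atLeastAtMost'[OF f] t])
  also have "\<dots> \<le> B * (LINT s:{0..t}|lborel. m)"
    using t le strong_family_nonneg[OF G]
    by (intro mult_left_mono set_integral_mono ft borel_integrable_atLeastAtMost' continuous_intros) auto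
  also have "\<dots> = B * (t * m)" using t by (simp add: set_integral_const)
  also have "\<dots> \<le> B * (T * m)"
    using t m strong_family_nonneg[OF G] by (intro mult_left_mono mult_right_mono) auto
  finally show ?thesis .
qed

section \<open>Volterra equations and mild solutions\<close>

text \<open>This is the linear operator V x = S * (K * x). With g t = S t x0 + (S * F) t the mild
  equation becomes the Volterra equation x = g - V x.\<close>

definition memory_term ::
  "(real \<Rightarrow> 'r::{banach,second_countable_topology} \<Rightarrow>\<^sub>L 'r) \<Rightarrow> (real \<Rightarrow> 'r \<Rightarrow>\<^sub>L 'r) \<Rightarrow>
     (real \<Rightarrow> 'r) \<Rightarrow> real \<Rightarrow> 'r" where
  "memory_term S K x = kernel_conv S (kernel_conv K x)"

text \<open>Causality: the value at \<open>t\<close> sees the state only on [0,t], so restricting a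
  solution to [0,T] preserves its equation.\<close>

lemma memory_term_cong:
  assumes "\<And>s. s \<in> {0..t} \<Longrightarrow> x s = y s"
  shows "memory_term S K x t = memory_term S K y t"
  unfolding memory_term_def by (intro kernel_conv_cong assms) auto

context
  fixes T B \<kappa> :: real and S K :: "real \<Rightarrow> 'r::{banach,second_countable_topology} \<Rightarrow>\<^sub>L 'r"
  assumes S: "strong_family T B S" and K: "strong_family T \<kappa> K" and T: "0 \<le> T"
begin

lemma continuous_on_memory_term:
  assumes "continuous_on {0..T} x"
  shows "continuous_on {0..T} (memory_term S K x)"
  unfolding memory_term_def
  by (intro continuous_on_kernel_conv[OF S] continuous_on_kernel_conv[OF K]
      borel_integrable_atLeastAtMost' assms)

lemma memory_term_diff:
  assumes "continuous_on {0..T} x" "continuous_on {0..T} y" "t \<in> {0..T}"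
  shows "memory_term S K (\<lambda>s. x s - y s) t = memory_term S K x t - memory_term S K y t"
proof -
  have "memory_term S K (\<lambda>s. x s - y s) t = kernel_conv S (\<lambda>s. kernel_conv K x s - kernel_conv K y s) t"
    unfolding memory_term_def using assms
    by (intro kernel_conv_cong kernel_conv_diff[OF K] borel_integrable_atLeastAtMost') auto
  then show ?thesis
    unfolding memory_term_def using assms
    by (simp add: kernel_conv_diff[OF S] continuous_on_kernel_conv[OF K] borel_integrable_atLeastAtMost')
qed

text \<open>Two convolutions with bounds \<open>B\<close> and \<kappa> produce the factor B \<kappa>
  / rate^2. As \<open>rate\<close> is at least 1 and at least 2 B \<kappa>, so is its square, and
  the factor is at most 1/2.\<close>

definition rate :: real where "rate = 1 + 2 * B * \<kappa>"

text \<open>Two time integrations of \<open>exp (b * t)\<close> gain a factor \<open>1 / b\<^sup>2\<close>, so the memory term is a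
  contraction in a sufficiently strong exponentially weighted supremum norm.\<close>

lemma memory_term_contraction:
  assumes x: "continuous_on {0..T} x" and t: "t \<in> {0..T}" and m: "0 \<le> m"
    and le: "\<And>s. s \<in> {0..T} \<Longrightarrow> norm (x s) \<le> m * exp (rate * s)"
  shows "norm (memory_term S K x t) \<le> m / 2 * exp (rate * t)"
proof -
  have B: "0 \<le> B" and \<kappa>: "0 \<le> \<kappa>" using strong_family_nonneg S K T by blast+
  have r: "1 \<le> rate" "2 * (B * \<kappa>) \<le> rate" using B \<kappa> by (auto simp: rate_def)
  have "norm (kernel_conv K x s) \<le> \<kappa> * m / rate * exp (rate * s)" if "s \<in> {0..T}" for s
    using r(1) by (intro kernel_conv_exp_weight[OF K x that m _ le]) auto
  then have "norm (memory_term S K x t) \<le> B * (\<kappa> * m / rate) / rate * exp (rate * t)"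
    unfolding memory_term_def using r(1) \<kappa> m
    by (intro kernel_conv_exp_weight[OF S _ t] continuous_on_kernel_conv[OF K]
        borel_integrable_atLeastAtMost' x) auto
  also have "B * (\<kappa> * m / rate) / rate = (B * \<kappa>) / (rate * rate) * m" by simp
  also have "(B * \<kappa>) / (rate * rate) * m \<le> 1 / 2 * m"
  proof (intro mult_right_mono m)
    have "2 * (B * \<kappa>) \<le> rate * rate" using r mult_mono[of 1 rate rate rate] by linarith
    then show "(B * \<kappa>) / (rate * rate) \<le> 1 / 2" using r by (simp add: field_simps)
  qed
  finally show ?thesis by (simp add: mult_right_mono)
qed

text \<open>Absorption at a maximiser \<open>s0\<close> of the weighted norm: writing
  \<open>z\<close> as residual minus memory term gives m \<le> e + m / 2. The case
  \<open>e = 0\<close> yields uniqueness, small \<open>e\<close> yields stability under perturbation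
  of the kernel.\<close>

lemma volterra_stability:
  assumes z: "continuous_on {0..T} z" and t: "t \<in> {0..T}"
    and le: "\<And>s. s \<in> {0..T} \<Longrightarrow> norm (z s + memory_term S K z s) \<le> e"
  shows "norm (z t) \<le> 2 * e * exp (rate * T)"
proof -
  have rate: "0 \<le> rate" using strong_family_nonneg[OF S T] strong_family_nonneg[OF K T] by (simp add: rate_def)
  have "continuous_on {0..T} (\<lambda>s. exp (- rate * s) * norm (z s))"
    by (intro continuous_intros z)
  with T have "\<exists>s0\<in>{0..T}. \<forall>s\<in>{0..T}.
      exp (- rate * s) * norm (z s) \<le> exp (- rate * s0) * norm (z s0)"
    by (intro continuous_attains_sup compact_Icc) auto
  then obtain s0 where s0: "s0 \<in> {0..T}"
    and max: "\<And>s. s \<in> {0..T} \<Longrightarrow> exp (- rate * s) * norm (z s) \<le> exp (- rate * s0) * norm (z s0)"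
    by blast
  define m where "m = exp (- rate * s0) * norm (z s0)"
  have zm: "norm (z s) \<le> m * exp (rate * s)" if "s \<in> {0..T}" for s
  proof -
    have "norm (z s) = (exp (- rate * s) * norm (z s)) * exp (rate * s)"
      by (simp add: exp_minus)
    also have "\<dots> \<le> m * exp (rate * s)" unfolding m_def by (intro mult_right_mono max that) simp
    finally show ?thesis .
  qed
  have m: "0 \<le> m" by (simp add: m_def)
  have e: "0 \<le> e" using le[OF t] norm_ge_zero order_trans by blast
  have "norm (z s0) \<le> norm (z s0 + memory_term S K z s0) + norm (memory_term S K z s0)"
    using norm_triangle_ineq4[of "z s0 + memory_term S K z s0" "memory_term S K z s0"] by simp
  also have "\<dots> \<le> e + m / 2 * exp (rate * s0)"
    by (intro add_mono le s0 memory_term_contraction z m zm)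
  finally have "exp (- rate * s0) * norm (z s0) \<le> exp (- rate * s0) * (e + m / 2 * exp (rate * s0))"
    by (intro mult_left_mono) auto
  also have "\<dots> = exp (- rate * s0) * e + m / 2" by (simp add: algebra_simps exp_minus)
  also have "\<dots> \<le> 1 * e + m / 2"
    using rate s0 e by (intro add_right_mono mult_right_mono) auto
  finally have "m \<le> 2 * e" by (simp add: m_def)
  then have "norm (z t) \<le> 2 * e * exp (rate * t)"
    using zm[OF t] by (meson exp_ge_zero mult_right_mono order_trans)
  also have "\<dots> \<le> 2 * e * exp (rate * T)"
    using t rate e by (intro mult_left_mono) (auto intro: mult_left_mono)
  finally show ?thesis .
qed

text \<open>Banach's fixed point theorem in the bounded continuous functions on the line, with the
  plain supremum norm. The weight is moved into the unknown, \<open>x = U y\<close>, and clamping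
  extends functions from [0,T] to the line; compactness of [0,T] makes the extensions
  bounded.\<close>

lemma volterra_existence:
  assumes g: "continuous_on {0..T} g"
  shows "\<exists>x. continuous_on {0..T} x \<and> (\<forall>t\<in>{0..T}. x t = g t - memory_term S K x t)"
proof -
  define U :: "(real \<Rightarrow>\<^sub>C 'r) \<Rightarrow> real \<Rightarrow> 'r" where "U y t = exp (rate * t) *\<^sub>R apply_bcontfun y t" for y t
  have U: "continuous_on {0..T} (U y)" for y
    unfolding U_def by (intro continuous_intros continuous_on_apply_bcontfun)
  define h where "h y t = exp (- rate * t) *\<^sub>R (g t - memory_term S K (U y) t)" for y t
  have h: "continuous_on {0..T} (h y)" for y
    unfolding h_def by (intro continuous_intros g continuous_on_memory_term U)
  have "(\<lambda>t. h y (clamp 0 T t)) \<in> bcontfun" for y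
    using clamp_continuous_on[where a = 0 and b = T and f = "h y"] h[of y]
      clamp_bounded[where a = 0 and b = T and f = "h y"]
      compact_imp_bounded[OF compact_continuous_image[OF h compact_Icc]]
    by (simp add: bcontfun_def)
  then have app: "apply_bcontfun (Bcontfun (\<lambda>t. h y (clamp 0 T t))) t = h y (clamp 0 T t)" for y t
    by (simp add: Bcontfun_inverse)
  have "dist (Bcontfun (\<lambda>t. h y (clamp 0 T t))) (Bcontfun (\<lambda>t. h z (clamp 0 T t))) \<le> 1 / 2 * dist y z" for y z
  proof (rule dist_bound)
    fix r
    define t where "t = clamp 0 T r"
    have t: "t \<in> {0..T}" unfolding t_def by (rule clamp_real_mem[OF T])
    have "norm (memory_term S K (\<lambda>s. U y s - U z s) t) \<le> dist y z / 2 * exp (rate * t)"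
    proof (rule memory_term_contraction[OF _ t])
      show "continuous_on {0..T} (\<lambda>s. U y s - U z s)" by (intro continuous_intros U)
      show "norm (U y s - U z s) \<le> dist y z * exp (rate * s)" for s
        using dist_bounded[of y s z]
        by (simp add: U_def dist_norm mult.commute flip: scaleR_diff_right)
    qed simp
    then have "norm (memory_term S K (U z) t - memory_term S K (U y) t) \<le> dist y z / 2 * exp (rate * t)"
      using memory_term_diff[OF U U t] by (simp add: norm_minus_commute)
    then have "exp (- rate * t) * norm (memory_term S K (U z) t - memory_term S K (U y) t)
        \<le> exp (- rate * t) * (dist y z / 2 * exp (rate * t))"
      by (intro mult_left_mono) auto
    also have "\<dots> = 1 / 2 * dist y z" by (simp add: exp_minus)
    also have "exp (- rate * t) * norm (memory_term S K (U z) t - memory_term S K (U y) t)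
        = dist (h y t) (h z t)"
      by (simp add: h_def dist_norm flip: scaleR_diff_right)
    finally show "dist (apply_bcontfun (Bcontfun (\<lambda>t. h y (clamp 0 T t))) r)
        (apply_bcontfun (Bcontfun (\<lambda>t. h z (clamp 0 T t))) r) \<le> 1 / 2 * dist y z"
      by (simp only: app t_def)
  qed
  then obtain y where y: "Bcontfun (\<lambda>t. h y (clamp 0 T t)) = y"
    using banach_fix_type[of "1 / 2" "\<lambda>y. Bcontfun (\<lambda>t. h y (clamp 0 T t))"] by auto
  have "U y t = g t - memory_term S K (U y) t" if "t \<in> {0..T}" for t
  proof -
    have "apply_bcontfun y t = h y t" using app[of y t] y clamp_real_id[OF that] by simp
    then show ?thesis unfolding U_def[of y t] by (simp add: h_def flip: exp_add)
  qed
  then show ?thesis using U by blast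
qed

context
  fixes F :: "real \<Rightarrow> 'r" and x0 :: 'r
  assumes F: "set_integrable lborel {0..T} F"
begin

text \<open>The integral splits because \<open>F\<close> is integrable and
  \<open>kernel_conv K x\<close> is continuous. The forcing then joins the known data, and the
  unknown enters only linearly.\<close>

lemma is_mild_solution_iff_volterra:
  "is_mild_solution T S K F x0 x \<longleftrightarrow> continuous_on {0..T} x \<and>
    (\<forall>t\<in>{0..T}. x t = blinfun_apply (S t) x0 + kernel_conv S F t - memory_term S K x t)"
proof -
  have "(LINT s:{0..t}|lborel. blinfun_apply (S (t - s)) (F s - kernel_conv K x s))
      = kernel_conv S F t - memory_term S K x t" if "continuous_on {0..T} x" "t \<in> {0..T}" for t
    using kernel_conv_diff[OF S F _ that(2), of "kernel_conv K x"] that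
      borel_integrable_atLeastAtMost'[OF continuous_on_kernel_conv[OF K borel_integrable_atLeastAtMost']]
    by (simp add: memory_term_def kernel_conv_def[of S "\<lambda>s. F s - kernel_conv K x s"])
  then show ?thesis unfolding is_mild_solution_def by (auto simp: add_diff_eq)
qed

lemma mild_solution_unique_existence:
  "\<exists>!x. x \<in> extensional {0..T} \<and> is_mild_solution T S K F x0 x"
proof (rule ex_ex1I)
  have "continuous_on {0..T} (\<lambda>t. blinfun_apply (S t) x0 + kernel_conv S F t)"
    using S by (intro continuous_on_add continuous_on_kernel_conv[OF S F]) (simp add: strong_family_def)
  from volterra_existence[OF this] obtain x where x: "continuous_on {0..T} x"
    "\<And>t. t \<in> {0..T} \<Longrightarrow> x t = blinfun_apply (S t) x0 + kernel_conv S F t - memory_term S K x t"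
    by blast
  define y where "y = restrict x {0..T}"
  have "continuous_on {0..T} y"
    using x(1) by (rule continuous_on_eq) (simp add: y_def)
  moreover have "y t = blinfun_apply (S t) x0 + kernel_conv S F t - memory_term S K y t" if "t \<in> {0..T}" for t
  proof -
    have "memory_term S K y t = memory_term S K x t"
      by (rule memory_term_cong) (use that in \<open>auto simp: y_def\<close>)
    then show ?thesis using x(2)[OF that] that by (simp add: y_def)
  qed
  ultimately show "\<exists>x. x \<in> extensional {0..T} \<and> is_mild_solution T S K F x0 x"
    unfolding is_mild_solution_iff_volterra y_def by blast
next
  fix x y
  assume x: "x \<in> extensional {0..T} \<and> is_mild_solution T S K F x0 x"
    and y: "y \<in> extensional {0..T} \<and> is_mild_solution T S K F x0 y"
  then have c: "continuous_on {0..T} x" "continuous_on {0..T} y"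
    by (auto simp: is_mild_solution_iff_volterra)
  \<comment> \<open>The known data cancel in the difference of two solutions, so its residual is
    exactly 0.\<close>
  have "norm (x s - y s + memory_term S K (\<lambda>s. x s - y s) s) \<le> 0" if s: "s \<in> {0..T}" for s
    unfolding memory_term_diff[OF c s] using x y s by (auto simp: is_mild_solution_iff_volterra)
  then have "norm (x t - y t) \<le> 2 * 0 * exp (rate * T)" if "t \<in> {0..T}" for t
    by (intro volterra_stability that continuous_intros c)
  then show "x = y" using x y by (intro extensionalityI[of _ "{0..T}"]) auto
qed

lemma is_mild_solution_mild_solution:
  "is_mild_solution T S K F x0 (mild_solution T S K F x0)"
  unfolding mild_solution_def using theI'[OF mild_solution_unique_existence] by blast

end

end

text \<open>The difference z = x_n - x solves z + S * (K_n * z) = - S * ((K_n - K) * x). The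
  residual involves the fixed limit \<open>x\<close>, bounded on [0,T], and the stability constant
  sees \<open>Kn n\<close> only through the common bound \<kappa>, so one \<open>C\<close> works for
  all n.\<close>

lemma mild_solution_convergence:
  fixes S K :: "real \<Rightarrow> 'r::{banach,second_countable_topology} \<Rightarrow>\<^sub>L 'r"
  assumes S: "strong_family T B S" and K: "strong_family T \<kappa> K" and Kn: "\<And>n. strong_family T \<kappa> (Kn n)"
    and T: "0 \<le> T" and F: "set_integrable lborel {0..T} F"
    and le: "\<And>n t. t \<in> {0..T} \<Longrightarrow> norm (Kn n t - K t) \<le> d n" and d: "d \<longlonglongrightarrow> 0"
  shows "converges_in_C T (\<lambda>n. mild_solution T S (Kn n) F x0) (mild_solution T S K F x0)"
proof -
  define x where "x = mild_solution T S K F x0"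
  define xn where "xn n = mild_solution T S (Kn n) F x0" for n
  have x: "continuous_on {0..T} x"
    and xeq: "\<And>t. t \<in> {0..T} \<Longrightarrow> x t = blinfun_apply (S t) x0 + kernel_conv S F t - memory_term S K x t"
    using is_mild_solution_mild_solution[OF S K T F, of x0]
    unfolding is_mild_solution_iff_volterra[OF S K T F] x_def by auto
  have xn: "continuous_on {0..T} (xn n)"
    and xneq: "\<And>t. t \<in> {0..T} \<Longrightarrow> xn n t = blinfun_apply (S t) x0 + kernel_conv S F t - memory_term S (Kn n) (xn n) t"
    for n
    using is_mild_solution_mild_solution[OF S Kn T F, of n x0]
    unfolding is_mild_solution_iff_volterra[OF S Kn T F] xn_def by auto
  obtain m where "\<forall>y\<in>x ` {0..T}. norm y \<le> m"
    using compact_imp_bounded[OF compact_continuous_image[OF x compact_Icc]]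
    unfolding bounded_iff by blast
  then have m: "norm (x t) \<le> m" if "t \<in> {0..T}" for t using that by blast
  \<comment> \<open>The exponential factor is the stability constant; \<open>B * T\<close> comes
    from the convolution with \<open>S\<close>, \<open>T * m\<close> from that of the kernel
    difference with \<open>x\<close>.\<close>
  define C where "C = 2 * exp (rate B \<kappa> * T) * (B * (T * (T * m)))"
  have "norm (xn n t - x t) \<le> C * d n" if t: "t \<in> {0..T}" for n t
  proof -
    have D: "strong_family T (d n) (\<lambda>s. Kn n s - K s)"
      using Kn[of n] K le[of _ n] unfolding strong_family_def
      by (auto simp: blinfun.diff_left intro!: continuous_on_diff)
    have "norm (xn n s - x s + memory_term S (Kn n) (\<lambda>s. xn n s - x s) s) \<le> B * (T * (d n * (T * m)))"
      if s: "s \<in> {0..T}" for s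
    proof -
      have "xn n s - x s + memory_term S (Kn n) (\<lambda>s. xn n s - x s) s
          = - (memory_term S (Kn n) x s - memory_term S K x s)"
        using memory_term_diff[OF S Kn T xn x s, of n n] xeq[OF s] xneq[OF s, of n] by simp
      also have "memory_term S (Kn n) x s - memory_term S K x s
        = kernel_conv S (\<lambda>r. kernel_conv (Kn n) x r - kernel_conv K x r) s"
        unfolding memory_term_def
        by (intro kernel_conv_diff[OF S, symmetric] s borel_integrable_atLeastAtMost'
            continuous_on_kernel_conv[OF Kn] continuous_on_kernel_conv[OF K] x)
      also have "\<dots> = kernel_conv S (kernel_conv (\<lambda>s. Kn n s - K s) x) s"
        using s by (intro kernel_conv_cong kernel_conv_kernel_diff[OF Kn K, symmetric]
            borel_integrable_atLeastAtMost' x) auto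
      also have "norm (- \<dots>) \<le> B * (T * (d n * (T * m)))"
        unfolding norm_minus_cancel
        by (intro kernel_conv_const_bound[OF S] s continuous_on_kernel_conv[OF D]
            borel_integrable_atLeastAtMost' kernel_conv_const_bound[OF D] m x)
      finally show ?thesis .
    qed
    from volterra_stability[OF S Kn T _ t this] show ?thesis
      by (auto simp: C_def mult_ac intro!: continuous_intros xn x)
  qed
  moreover have "(\<lambda>n. C * d n) \<longlonglongrightarrow> C * 0" by (intro tendsto_intros d)
  ultimately have "uniform_limit {0..T} xn x sequentially"
    by (intro uniform_limitI)
      (smt (verit, ccfv_SIG) dist_norm eventually_mono mult_zero_right order_tendstoD(2))
  then show ?thesis unfolding converges_in_C_def using x xn by (simp add: x_def xn_def[abs_def])
qed

section \<open>Convergence of the reductions\<close>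

lemma kernel_conv_uniform_limit:
  fixes G :: "real \<Rightarrow> 'r::{banach,second_countable_topology} \<Rightarrow>\<^sub>L 'r"
  assumes G: "strong_family T B G" and T: "0 \<le> T" and "converges_in_C T f g"
  shows "converges_in_C T (\<lambda>n. kernel_conv G (f n)) (kernel_conv G g)"
proof -
  have f: "continuous_on {0..T} (f n)" and g: "continuous_on {0..T} g"
    and lim: "uniform_limit {0..T} f g sequentially" for n
    using assms(3) by (auto simp: converges_in_C_def)
  have "uniform_limit {0..T} (\<lambda>n. kernel_conv G (f n)) (kernel_conv G g) sequentially"
  proof (rule uniform_limitI)
    fix e :: real assume e: "0 < e"
    \<comment> \<open>The summand 1 keeps the denominator positive and makes the final estimate
      strict.\<close>
    define d where "d = e / (B * T + 1)"
    have BT: "0 \<le> B * T" using strong_family_nonneg[OF G T] T by simp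
    then have d: "0 < d" using e by (simp add: d_def)
    from uniform_limitD[OF lim d]
    show "\<forall>\<^sub>F n in sequentially. \<forall>t\<in>{0..T}. dist (kernel_conv G (f n) t) (kernel_conv G g t) < e"
    proof eventually_elim
      case (elim n)
      show ?case
      proof
        fix t assume t: "t \<in> {0..T}"
        have "norm (kernel_conv G (\<lambda>s. f n s - g s) t) \<le> B * (T * d)"
          using elim by (intro kernel_conv_const_bound[OF G _ t] continuous_on_diff f g)
            (auto simp: dist_norm less_imp_le)
        also have "\<dots> < (B * T + 1) * d" using d by (simp add: algebra_simps)
        also have "\<dots> = e" using BT by (simp add: d_def)
        finally show "dist (kernel_conv G (f n) t) (kernel_conv G g t) < e"
          using kernel_conv_diff[OF G _ _ t, of "f n" g] f g
          by (simp add: dist_norm borel_integrable_atLeastAtMost')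
      qed
    qed
  qed
  then show ?thesis
    unfolding converges_in_C_def
    by (intro conjI allI continuous_on_kernel_conv[OF G] borel_integrable_atLeastAtMost' f g)
qed

text \<open>Application is bounded bilinear and the limit \<open>y\<close> is bounded on the compact
  interval. Varying operators serve the reduced couplings, a constant one the square root in the
  energy.\<close>

lemma converges_in_C_blinfun_apply:
  assumes "converges_in_C T x y" and "A \<longlonglongrightarrow> B"
  shows "converges_in_C T (\<lambda>n t. blinfun_apply (A n) (x n t)) (\<lambda>t. blinfun_apply B (y t))"
proof -
  have x: "continuous_on {0..T} (x n)" and y: "continuous_on {0..T} y"
    and lim: "uniform_limit {0..T} x y sequentially" for n
    using assms(1) by (auto simp: converges_in_C_def)
  have "uniform_limit {0..T} (\<lambda>n t. A n) (\<lambda>t. B) sequentially"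
    by (rule uniform_limitI) (use tendstoD[OF assms(2)] in \<open>auto elim: eventually_mono\<close>)
  then have "uniform_limit {0..T} (\<lambda>n t. blinfun_apply (A n) (x n t)) (\<lambda>t. blinfun_apply B (y t)) sequentially"
    by (rule bounded_bilinear.bounded_uniform_limit[OF bounded_bilinear_blinfun_apply _ lim])
      (simp_all add: image_constant_conv compact_imp_bounded[OF compact_continuous_image[OF y compact_Icc]])
  then show ?thesis
    unfolding converges_in_C_def by (intro conjI allI continuous_intros x y)
qed

text \<open>The operator \<open>sqrt_op L\<close> enters only as a bounded operator, so the existence of the
  square root plays no role here.\<close>

lemma energy_dissipation_convergence:
  assumes T: "0 \<le> T" and q: "converges_in_C T qn q"
  shows "(\<lambda>n. energy_dissipation T L (qn n)) \<longlonglongrightarrow> energy_dissipation T L q"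
proof -
  define R where "R = blinfun_apply (sqrt_op L)"
  have "converges_in_C T (\<lambda>n t. R (qn n t)) (\<lambda>t. R (q t))"
    unfolding R_def by (rule converges_in_C_blinfun_apply[OF q tendsto_const])
  then have c: "continuous_on {0..T} (\<lambda>t. R (qn n t))" and c': "continuous_on {0..T} (\<lambda>t. R (q t))"
    and lim: "uniform_limit {0..T} (\<lambda>n t. R (qn n t)) (\<lambda>t. R (q t)) sequentially" for n
    by (auto simp: converges_in_C_def)
  have "uniform_limit {0..T} (\<lambda>n t. R (qn n t) \<bullet> R (qn n t)) (\<lambda>t. R (q t) \<bullet> R (q t)) sequentially"
    by (rule bounded_bilinear.bounded_uniform_limit[OF bounded_bilinear_inner lim lim];
        rule compact_imp_bounded[OF compact_continuous_image[OF c' compact_Icc]])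
  then have lim2: "uniform_limit {0..T} (\<lambda>n t. (norm (R (qn n t)))\<^sup>2) (\<lambda>t. (norm (R (q t)))\<^sup>2) sequentially"
    by (simp add: power2_norm_eq_inner)
  have c2: "continuous_on {0..T} (\<lambda>t. (norm (R (qn n t)))\<^sup>2)" and
    c2': "continuous_on {0..T} (\<lambda>t. (norm (R (q t)))\<^sup>2)" for n
    by (intro continuous_intros c c')+
  \<comment> \<open>The limit theorem speaks of the gauge integral, which for these continuous
    integrands agrees with the Lebesgue integral of the definition.\<close>
  obtain I J where I: "\<And>n. ((\<lambda>t. (norm (R (qn n t)))\<^sup>2) has_integral I n) {0..T}"
    and J: "((\<lambda>t. (norm (R (q t)))\<^sup>2) has_integral J) {0..T}" and IJ: "I \<longlonglongrightarrow> J"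
    using uniform_limit_integral[OF lim2 c2 sequentially_bot] by blast
  have "(LINT t:{0..T}|lborel. (norm (R (qn n t)))\<^sup>2) = I n" for n
    using set_borel_integral_eq_integral(2)[OF borel_integrable_atLeastAtMost'[OF c2]] integral_unique[OF I]
    by simp
  moreover have "(LINT t:{0..T}|lborel. (norm (R (q t)))\<^sup>2) = J"
    using set_borel_integral_eq_integral(2)[OF borel_integrable_atLeastAtMost'[OF c2']] integral_unique[OF J]
    by simp
  moreover have "(\<lambda>n. qn n T) \<longlonglongrightarrow> q T"
    using q T by (auto simp: converges_in_C_def intro: tendsto_uniform_limitI)
  ultimately show ?thesis
    unfolding energy_dissipation_def R_def[symmetric] by (simp only:) (intro tendsto_intros IJ)
qed

text \<open>The image of the unit ball is totally bounded. Pointwise convergence is uniform on a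
  finite \<open>e / 4\<close>-net, and the bound 1 on \<open>R n\<close> transfers it to the whole
  image. Two quarters give \<open>e / 2\<close>; the slack turns the non-strict operator bound into
  a strict one.\<close>

lemma compact_op_norm_convergence:
  fixes R :: "nat \<Rightarrow> 'a::real_normed_vector \<Rightarrow>\<^sub>L 'b::real_normed_vector" and C :: "'c::real_normed_vector \<Rightarrow>\<^sub>L 'a"
  assumes "compact_op C" and le: "\<And>n. norm (R n) \<le> 1" and lim: "\<And>v. (\<lambda>n. blinfun_apply (R n) v) \<longlonglongrightarrow> 0"
  shows "(\<lambda>n. norm (R n o\<^sub>L C)) \<longlonglongrightarrow> 0"
proof (rule LIMSEQ_I)
  fix e :: real assume e: "0 < e"
  define D where "D = blinfun_apply C ` cball 0 1"
  have "compact (closure D)" using assms(1) unfolding compact_op_def D_def by blast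
  then obtain k where k: "finite k" "closure D \<subseteq> (\<Union>x\<in>k. ball x (e / 4))"
    using e unfolding compact_eq_totally_bounded by (metis divide_pos_pos zero_less_numeral)
  have "\<forall>\<^sub>F n in sequentially. \<forall>x\<in>k. norm (blinfun_apply (R n) x) < e / 4"
  proof (rule eventually_ball_finite[OF k(1)], rule)
    fix x
    show "\<forall>\<^sub>F n in sequentially. norm (blinfun_apply (R n) x) < e / 4"
      using tendstoD[OF lim[of x], of "e / 4"] e by simp
  qed
  then have "\<forall>\<^sub>F n in sequentially. norm (R n o\<^sub>L C) < e"
  proof eventually_elim
    case (elim n)
    have unit: "norm (blinfun_apply (R n o\<^sub>L C) h) \<le> e / 2" if "norm h \<le> 1" for h
    proof -
      have "blinfun_apply C h \<in> D" using that by (simp add: D_def)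
      then have "blinfun_apply C h \<in> closure D" using closure_subset by blast
      then obtain x where x: "x \<in> k" "norm (blinfun_apply C h - x) < e / 4"
        using k(2) by (auto simp: dist_norm norm_minus_commute)
      have "norm (blinfun_apply (R n) (blinfun_apply C h - x)) \<le> norm (R n) * norm (blinfun_apply C h - x)"
        by (rule norm_blinfun)
      also have "\<dots> \<le> 1 * norm (blinfun_apply C h - x)" by (intro mult_right_mono le) simp
      finally have "norm (blinfun_apply (R n) (blinfun_apply C h - x)) \<le> e / 4" using x(2) by simp
      moreover have "norm (blinfun_apply (R n) x) \<le> e / 4" using elim x(1) by (simp add: less_imp_le)
      ultimately show ?thesis
        using norm_triangle_ineq[of "blinfun_apply (R n) (blinfun_apply C h - x)" "blinfun_apply (R n) x"]
        by (simp add: blinfun.diff_right)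
    qed
    have "norm (R n o\<^sub>L C) \<le> e / 2"
    proof (rule norm_blinfun_bound)
      fix h
      show "norm (blinfun_apply (R n o\<^sub>L C) h) \<le> e / 2 * norm h"
      proof (cases "h = 0")
        case False
        then show ?thesis using unit[of "(1 / norm h) *\<^sub>R h"]
          by (simp add: blinfun.scaleR_right field_simps)
      qed simp
    qed (use e in simp)
    then show ?case using e by simp
  qed
  then show "\<exists>N. \<forall>n\<ge>N. norm (norm (R n o\<^sub>L C) - 0) < e"
    by (simp add: eventually_sequentially)
qed

section \<open>Memory kernels of projected couplings\<close>

lemma norm_orth_projection_le_1: "orth_projection P \<Longrightarrow> norm P \<le> 1"
  by (rule norm_blinfun_bound) (auto simp: orth_projection_norm_le)

lemma orth_projection_complement:
  assumes "orth_projection P"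
  shows "orth_projection (id_blinfun - P)"
proof -
  have "blinfun_apply P (blinfun_apply P x) = blinfun_apply P x" for x
    using orth_projection_apply_range[OF assms] by blast
  moreover have "adj (id_blinfun - P) = id_blinfun - P"
    using assms selfadjoint_inner[of P] unfolding orth_projection_def
    by (intro adj_eqI) (simp add: blinfun.diff_left inner_diff_left inner_diff_right)
  ultimately show ?thesis unfolding orth_projection_def selfadjoint_def
    by (auto intro!: blinfun_eqI simp: blinfun.diff_left blinfun.diff_right)
qed

lemma continuous_on_memory_kernel: "continuous_on X (memory_kernel L C)"
  unfolding memory_kernel_def[abs_def]
  by (intro bounded_bilinear.continuous_on[OF bounded_bilinear_blinfun_compose]
      continuous_on_const continuous_on_exp_op)

lemma norm_memory_kernel_le:
  assumes "nonneg_op L" "0 \<le> t"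
  shows "norm (memory_kernel L C t) \<le> norm C * norm C"
proof -
  have "norm (adj C o\<^sub>L exp_op ((- t) *\<^sub>R L)) \<le> norm C * 1"
    by (intro order_trans[OF norm_blinfun_compose] mult_mono norm_adj_le norm_exp_op_le_1 assms) auto
  then show ?thesis unfolding memory_kernel_def
    by (intro order_trans[OF norm_blinfun_compose mult_right_mono]) simp_all
qed

text \<open>The free parameter \<open>c\<close> lets the full kernel and all reduced kernels receive
  the same bound, as the stability estimate requires.\<close>

lemma strong_family_memory_kernel:
  assumes "nonneg_op L" "norm C \<le> c"
  shows "strong_family T (c * c) (memory_kernel L C)"
proof -
  have "norm C * norm C \<le> c * c" using assms(2) by (intro mult_mono) (auto intro: order_trans[OF norm_ge_zero])
  then have "norm (memory_kernel L C t) \<le> c * c" if "t \<in> {0..T}" for t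
    using norm_memory_kernel_le[OF assms(1), of t C] that by simp
  then show ?thesis
    unfolding strong_family_def
    using bounded_linear.continuous_on[OF blinfun.bounded_linear_left continuous_on_memory_kernel] by blast
qed

lemma strong_family_exp_op:
  "nonneg_op L \<Longrightarrow> strong_family T 1 (\<lambda>t. exp_op ((- t) *\<^sub>R L))"
  unfolding strong_family_def
  using bounded_linear.continuous_on[OF blinfun.bounded_linear_left continuous_on_exp_op] norm_exp_op_le_1
  by (metis atLeastAtMost_iff)

lemma hidden_state_eq_kernel_conv:
  "hidden_state L C x = kernel_conv (\<lambda>t. exp_op ((- t) *\<^sub>R L)) (\<lambda>s. blinfun_apply C (x s))"
  by (rule ext) (simp only: hidden_state_def kernel_conv_def)

text \<open>The adjoint and the coupling each contribute one \<open>P\<close>. Commuting one past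
  the exponential and using idempotence merges them, so the difference is linear in
  \<open>id_blinfun - P\<close>.\<close>

lemma memory_kernel_projection_diff:
  assumes "orth_projection P" and "P o\<^sub>L L = L o\<^sub>L P"
  shows "memory_kernel L (P o\<^sub>L C) t - memory_kernel L C t
    = - (adj C o\<^sub>L exp_op ((- t) *\<^sub>R L) o\<^sub>L ((id_blinfun - P) o\<^sub>L C))"
proof (rule blinfun_eqI)
  fix x
  define E where "E = exp_op ((- t) *\<^sub>R L)"
  have "adj P = P" using assms(1) by (simp add: orth_projection_def selfadjoint_def)
  moreover have "blinfun_apply P (blinfun_apply P v) = blinfun_apply P v" for v
    using orth_projection_apply_range[OF assms(1)] by blast
  moreover have "blinfun_apply P (blinfun_apply E v) = blinfun_apply E (blinfun_apply P v)" for v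
    using arg_cong[OF exp_op_commute[OF assms(2), of "- t"], of "\<lambda>A. blinfun_apply A v"]
    by (simp add: E_def)
  ultimately show "blinfun_apply (memory_kernel L (P o\<^sub>L C) t - memory_kernel L C t) x
    = blinfun_apply (- (adj C o\<^sub>L exp_op ((- t) *\<^sub>R L) o\<^sub>L ((id_blinfun - P) o\<^sub>L C))) x"
    unfolding memory_kernel_def E_def[symmetric]
    by (simp add: adj_compose blinfun.diff_left blinfun.diff_right blinfun.minus_left)
qed

lemma norm_memory_kernel_projection_diff_le:
  assumes "orth_projection P" and "P o\<^sub>L L = L o\<^sub>L P" and "nonneg_op L" and "0 \<le> t"
  shows "norm (memory_kernel L (P o\<^sub>L C) t - memory_kernel L C t) \<le> norm C * norm ((id_blinfun - P) o\<^sub>L C)"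
proof -
  have "norm (adj C o\<^sub>L exp_op ((- t) *\<^sub>R L)) \<le> norm C * 1"
    by (intro order_trans[OF norm_blinfun_compose] mult_mono norm_adj_le norm_exp_op_le_1 assms) auto
  then show ?thesis unfolding memory_kernel_projection_diff[OF assms(1,2)] norm_minus_cancel
    by (intro order_trans[OF norm_blinfun_compose mult_right_mono]) simp_all
qed

section \<open>Spectral decomposition of the kernel\<close>

text \<open>Mutual orthogonality has to be derived from the symmetry of \<open>L\<close>: for
  \<open>b = Q j v\<close> and \<open>a = Q i b\<close>, distinct eigenvalues force
  \<open>a \<bullet> b = 0\<close>, whereas \<open>a \<bullet> b\<close> is also |a|^2.\<close>

lemma spectral_projections_orthogonal:
  assumes L: "selfadjoint L" and sd: "spectral_decomposition_on L V m ev Q"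
    and ij: "i \<in> {1..m}" "j \<in> {1..m}" "i \<noteq> j"
  shows "blinfun_apply (Q i) (blinfun_apply (Q j) v) = 0"
proof -
  define b where "b = blinfun_apply (Q j) v"
  define a where "a = blinfun_apply (Q i) b"
  have Q: "orth_projection (Q k)" "range (blinfun_apply (Q k)) = eigenspace_on L V (ev k)" if "k \<in> {1..m}" for k
    using sd that unfolding spectral_decomposition_on_def by auto
  have "ev i \<noteq> ev j"
    using sd ij unfolding spectral_decomposition_on_def bij_betw_def inj_on_def by blast
  moreover have "a \<in> eigenspace_on L V (ev i)" "b \<in> eigenspace_on L V (ev j)"
    using Q(2)[OF ij(1)] Q(2)[OF ij(2)] by (auto simp: a_def b_def)
  then have "ev i * (a \<bullet> b) = ev j * (a \<bullet> b)"
    using selfadjoint_inner[OF L, of a b] by (simp add: eigenspace_on_def)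
  ultimately have "a \<bullet> b = 0" by simp
  then have "(norm a)\<^sup>2 = 0" using orth_projection_inner_self[OF Q(1)[OF ij(1)], of b] by (simp add: a_def)
  then show ?thesis by (simp add: a_def b_def)
qed

text \<open>The defect \<open>w = v - (\<Sum>j. Q j v)\<close> is annihilated by \<open>L\<close>; were it nonzero, it would be an
  eigenvector for the eigenvalue \<open>0\<close>, yet every \<open>Q k\<close> annihilates it.\<close>

lemma spectral_projections_sum:
  assumes L: "selfadjoint L" and sd: "spectral_decomposition_on L V m ev Q"
    and V: "subspace V" and v: "v \<in> V"
  shows "(\<Sum>j=1..m. blinfun_apply (Q j) v) = v"
proof (rule ccontr)
  assume neq: "(\<Sum>j=1..m. blinfun_apply (Q j) v) \<noteq> v"
  define w where "w = v - (\<Sum>j=1..m. blinfun_apply (Q j) v)"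
  have Q: "orth_projection (Q k)" "range (blinfun_apply (Q k)) = eigenspace_on L V (ev k)" if "k \<in> {1..m}" for k
    using sd that unfolding spectral_decomposition_on_def by auto
  have Qv: "blinfun_apply (Q j) v \<in> eigenspace_on L V (ev j)" if "j \<in> {1..m}" for j
    using Q(2)[OF that] by blast
  then have "w \<in> V" unfolding w_def eigenspace_on_def
    by (intro subspace_diff V v subspace_sum) auto
  moreover have "blinfun_apply L w = 0"
  proof -
    have "blinfun_apply L v = (\<Sum>j=1..m. ev j *\<^sub>R blinfun_apply (Q j) v)"
      using sd v unfolding spectral_decomposition_on_def by blast
    also have "\<dots> = (\<Sum>j=1..m. blinfun_apply L (blinfun_apply (Q j) v))"
      using Qv by (intro sum.cong) (auto simp: eigenspace_on_def)
    finally show ?thesis by (simp add: w_def blinfun.diff_right blinfun.sum_right)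
  qed
  ultimately have w: "w \<in> eigenspace_on L V 0" by (simp add: eigenspace_on_def)
  moreover have "w \<noteq> 0" using neq by (simp add: w_def)
  ultimately have "0 \<in> eigenvalues_on L V" unfolding eigenvalues_on_def by blast
  moreover have "eigenvalues_on L V = ev ` {1..m}"
    using sd unfolding spectral_decomposition_on_def bij_betw_def by simp
  \<comment> \<open>\<open>ev\<close> exhausts the eigenvalues, so some \<open>Q k\<close> projects
    onto the null eigenspace and has to fix \<open>w\<close>.\<close>
  ultimately obtain k where k: "k \<in> {1..m}" "ev k = 0" by auto
  have "w \<in> range (blinfun_apply (Q k))" using Q(2)[OF k(1)] k(2) w by simp
  then have "w = blinfun_apply (Q k) w"
    by (rule orth_projection_apply_range[OF Q(1)[OF k(1)], symmetric])
  also have "\<dots> = blinfun_apply (Q k) v - (\<Sum>j=1..m. blinfun_apply (Q k) (blinfun_apply (Q j) v))"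
    by (simp add: w_def blinfun.diff_right blinfun.sum_right)
  also have "(\<Sum>j=1..m. blinfun_apply (Q k) (blinfun_apply (Q j) v))
      = (\<Sum>j=1..m. if j = k then blinfun_apply (Q k) v else 0)"
    using orth_projection_apply_range[OF Q(1)[OF k(1)], of "blinfun_apply (Q k) v"]
      spectral_projections_orthogonal[OF L sd k(1)]
    by (intro sum.cong) auto
  also have "\<dots> = blinfun_apply (Q k) v" using k(1) by simp
  finally show False using \<open>w \<noteq> 0\<close> by simp
qed

lemma exp_op_spectral:
  assumes L: "selfadjoint L" and sd: "spectral_decomposition_on L V m ev Q"
    and V: "subspace V" and v: "v \<in> V"
  shows "blinfun_apply (exp_op (t *\<^sub>R L)) v = (\<Sum>j=1..m. exp (t * ev j) *\<^sub>R blinfun_apply (Q j) v)"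
proof -
  have "blinfun_apply L (blinfun_apply (Q j) v) = ev j *\<^sub>R blinfun_apply (Q j) v" if "j \<in> {1..m}" for j
    using sd that unfolding spectral_decomposition_on_def eigenspace_on_def by blast
  then have "(\<Sum>j=1..m. exp (t * ev j) *\<^sub>R blinfun_apply (Q j) v)
      = (\<Sum>j=1..m. blinfun_apply (exp_op (t *\<^sub>R L)) (blinfun_apply (Q j) v))"
    by (intro sum.cong refl exp_op_eigenvector[symmetric])
  then show ?thesis
    by (simp only: spectral_projections_sum[OF assms] blinfun.sum_right[symmetric])
qed

lemma memory_kernel_spectral:
  assumes "selfadjoint L" "spectral_decomposition_on L V m ev Q" "subspace V" "range (blinfun_apply C) \<subseteq> V"
  shows "memory_kernel L C t = (\<Sum>j=1..m. exp (- ev j * t) *\<^sub>R (adj C o\<^sub>L Q j o\<^sub>L C))"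
proof (rule blinfun_eqI)
  fix x
  have "blinfun_apply C x \<in> V" using assms(4) by blast
  then show "blinfun_apply (memory_kernel L C t) x
      = blinfun_apply (\<Sum>j=1..m. exp (- ev j * t) *\<^sub>R (adj C o\<^sub>L Q j o\<^sub>L C)) x"
    using exp_op_spectral[OF assms(1-3), of "blinfun_apply C x" "- t"]
    by (simp add: memory_kernel_def blinfun.sum_left blinfun.sum_right blinfun.scaleR_left
        blinfun.scaleR_right mult.commute)
qed

section \<open>Symmetry and sign of the weights\<close>

lemma selfadjoint_conjugation: "selfadjoint Q \<Longrightarrow> selfadjoint (adj C o\<^sub>L Q o\<^sub>L C)"
  unfolding selfadjoint_def[of "adj C o\<^sub>L Q o\<^sub>L C"]
  by (rule adj_eqI) (metis adj_works blinfun_apply_blinfun_compose inner_commute selfadjoint_inner)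

lemma nonneg_op_conjugation: "nonneg_op Q \<Longrightarrow> nonneg_op (adj C o\<^sub>L Q o\<^sub>L C)"
  unfolding nonneg_op_def by (metis adj_works blinfun_apply_blinfun_compose inner_commute)

lemma nonneg_op_orth_projection: "orth_projection P \<Longrightarrow> nonneg_op P"
  by (simp add: nonneg_op_def orth_projection_inner_self)

lemma subspace_range_blinfun: "subspace (range (blinfun_apply A))"
  by (rule linear_subspace_image[OF bounded_linear.linear[OF blinfun.bounded_linear_right] subspace_UNIV])

theorem proposition5p13:
  fixes L :: "'u::{real_inner,banach,second_countable_topology} \<Rightarrow>\<^sub>L 'u"
    and P :: "nat \<Rightarrow> 'u \<Rightarrow>\<^sub>L 'u"
    and C :: "'r::{real_inner,banach,second_countable_topology} \<Rightarrow>\<^sub>L 'u"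
    and T :: real
  assumes "selfadjoint L" and "nonneg_op L"
    and "\<And>N. orth_projection (P N)"
    and "\<And>N. finite_dim_subspace (range (blinfun_apply (P N)))"
    and "incseq (\<lambda>N. range (blinfun_apply (P N)))"
    and "\<And>N. P N o\<^sub>L L = L o\<^sub>L P N"
    and "\<And>u. (\<lambda>N. blinfun_apply (P N) u) \<longlonglongrightarrow> u"
    and "compact_op C"
    and "T > 0"
  shows
    "(\<lambda>N. norm ((id_blinfun - P N) o\<^sub>L C)) \<longlonglongrightarrow> 0 \<and>
     (\<forall>N. set_integrable lborel {0..T}
            (\<lambda>t. norm (memory_kernel L (P N o\<^sub>L C) t - memory_kernel L C t)) \<and>
          kernel_norm T (\<lambda>t. memory_kernel L (P N o\<^sub>L C) t - memory_kernel L C t)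
            \<le> 2 * T * norm C * norm ((id_blinfun - P N) o\<^sub>L C)) \<and>
     (\<forall>(D :: 'r set) A S M \<omega> F x0.
        C0_semigroup S \<and> generator_of D A S \<and>
        M \<ge> 1 \<and> (\<forall>t\<ge>0. norm (S t) \<le> M * exp (\<omega> * t)) \<and>
        set_integrable lborel {0..T} F \<longrightarrow>
          (\<forall>N. \<exists>!x. x \<in> extensional {0..T} \<and>
                 is_mild_solution T S (memory_kernel L (P N o\<^sub>L C)) F x0 x) \<and>
          (\<exists>!x. x \<in> extensional {0..T} \<and> is_mild_solution T S (memory_kernel L C) F x0 x) \<and>
          converges_in_C T (\<lambda>N. mild_solution T S (memory_kernel L (P N o\<^sub>L C)) F x0)
            (mild_solution T S (memory_kernel L C) F x0) \<and>
          stable_reduction T S F x0 L C (\<lambda>N. L) (\<lambda>N. P N o\<^sub>L C)) \<and>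
     (\<forall>N. finite_dim_subspace (range (blinfun_apply (P N))) \<and>
          blinfun_apply L ` range (blinfun_apply (P N)) \<subseteq> range (blinfun_apply (P N)) \<and>
          (\<forall>m ev Q. spectral_decomposition_on L (range (blinfun_apply (P N))) m ev Q \<longrightarrow>
             (\<forall>t. memory_kernel L (P N o\<^sub>L C) t =
                (\<Sum>j=1..m. exp (- ev j * t) *\<^sub>R (adj (P N o\<^sub>L C) o\<^sub>L Q j o\<^sub>L (P N o\<^sub>L C)))) \<and>
             (\<forall>j\<in>{1..m}. selfadjoint (adj (P N o\<^sub>L C) o\<^sub>L Q j o\<^sub>L (P N o\<^sub>L C)) \<and>
                nonneg_op (adj (P N o\<^sub>L C) o\<^sub>L Q j o\<^sub>L (P N o\<^sub>L C)))))"
proof (intro conjI)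
  have projC: "norm (P N o\<^sub>L C) \<le> norm C" for N
    using order_trans[OF norm_blinfun_compose mult_right_mono[OF norm_orth_projection_le_1[OF assms(3)]]]
    by (metis mult_1 norm_ge_zero)
  have d0: "(\<lambda>N. norm ((id_blinfun - P N) o\<^sub>L C)) \<longlonglongrightarrow> 0"
  proof (rule compact_op_norm_convergence[OF assms(8)])
    show "norm (id_blinfun - P n) \<le> 1" for n
      by (intro norm_orth_projection_le_1 orth_projection_complement assms(3))
    show "(\<lambda>n. blinfun_apply (id_blinfun - P n) v) \<longlonglongrightarrow> 0" for v
      using tendsto_diff[OF tendsto_const[of v] assms(7)[of v]] by (simp add: blinfun.diff_left)
  qed
  then show "(\<lambda>N. norm ((id_blinfun - P N) o\<^sub>L C)) \<longlonglongrightarrow> 0" .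
  have diff: "norm (memory_kernel L (P N o\<^sub>L C) t - memory_kernel L C t)
      \<le> norm C * norm ((id_blinfun - P N) o\<^sub>L C)" if "0 \<le> t" for N t
    by (rule norm_memory_kernel_projection_diff_le[OF assms(3,6,2) that])
  show "\<forall>N. set_integrable lborel {0..T}
            (\<lambda>t. norm (memory_kernel L (P N o\<^sub>L C) t - memory_kernel L C t)) \<and>
          kernel_norm T (\<lambda>t. memory_kernel L (P N o\<^sub>L C) t - memory_kernel L C t)
            \<le> 2 * T * norm C * norm ((id_blinfun - P N) o\<^sub>L C)"
  proof (intro allI conjI)
    fix N
    define d where "d = norm C * norm ((id_blinfun - P N) o\<^sub>L C)"
    show int: "set_integrable lborel {0..T} (\<lambda>t. norm (memory_kernel L (P N o\<^sub>L C) t - memory_kernel L C t))"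
      by (intro borel_integrable_atLeastAtMost' continuous_on_norm continuous_on_diff continuous_on_memory_kernel)
    have "kernel_norm T (\<lambda>t. memory_kernel L (P N o\<^sub>L C) t - memory_kernel L C t) \<le> (LINT t:{0..T}|lborel. d)"
      unfolding kernel_norm_def d_def
      by (intro set_integral_mono int borel_integrable_atLeastAtMost' continuous_on_const diff) auto
    also have "\<dots> = T * d" using \<open>T > 0\<close> by (simp add: set_integral_const)
    \<comment> \<open>A factor 2 arises when the adjoint and the coupling are perturbed one after
      the other. The exact formula for the kernel difference has a single term, so half the stated
      bound is already reached.\<close>
    also have "\<dots> \<le> 2 * (T * d)" using \<open>T > 0\<close> by (simp add: d_def)
    finally show "kernel_norm T (\<lambda>t. memory_kernel L (P N o\<^sub>L C) t - memory_kernel L C t)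
        \<le> 2 * T * norm C * norm ((id_blinfun - P N) o\<^sub>L C)"
      by (simp add: d_def mult_ac)
  qed
  show "\<forall>(D :: 'r set) A S M \<omega> F x0.
        C0_semigroup S \<and> generator_of D A S \<and>
        M \<ge> 1 \<and> (\<forall>t\<ge>0. norm (S t) \<le> M * exp (\<omega> * t)) \<and>
        set_integrable lborel {0..T} F \<longrightarrow>
          (\<forall>N. \<exists>!x. x \<in> extensional {0..T} \<and>
                 is_mild_solution T S (memory_kernel L (P N o\<^sub>L C)) F x0 x) \<and>
          (\<exists>!x. x \<in> extensional {0..T} \<and> is_mild_solution T S (memory_kernel L C) F x0 x) \<and>
          converges_in_C T (\<lambda>N. mild_solution T S (memory_kernel L (P N o\<^sub>L C)) F x0)
            (mild_solution T S (memory_kernel L C) F x0) \<and>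
          stable_reduction T S F x0 L C (\<lambda>N. L) (\<lambda>N. P N o\<^sub>L C)"
  proof (intro allI impI, elim conjE)
    fix D :: "'r set" and A :: "'r \<Rightarrow> 'r" and S :: "real \<Rightarrow> 'r \<Rightarrow>\<^sub>L 'r" and M \<omega> :: real
      and F :: "real \<Rightarrow> 'r" and x0 :: 'r
    assume S: "C0_semigroup S" and M: "M \<ge> 1" and growth: "\<forall>t\<ge>0. norm (S t) \<le> M * exp (\<omega> * t)"
      and F: "set_integrable lborel {0..T} F"
    have T: "0 \<le> T" using \<open>T > 0\<close> by simp
    have SB: "strong_family T (M * exp (\<bar>\<omega>\<bar> * T)) S"
    proof -
      have "norm (S t) \<le> M * exp (\<bar>\<omega>\<bar> * T)" if "t \<in> {0..T}" for t
      proof -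
        \<comment> \<open>The absolute value covers a negative growth exponent.\<close>
        have "\<omega> * t \<le> \<bar>\<omega>\<bar> * T" using that by (intro mult_mono) auto
        then have "M * exp (\<omega> * t) \<le> M * exp (\<bar>\<omega>\<bar> * T)" using M by simp
        then show ?thesis using growth that by (meson atLeastAtMost_iff order_trans)
      qed
      moreover have "continuous_on {0..T} (\<lambda>t. blinfun_apply (S t) v)" for v
        using S unfolding C0_semigroup_def by (auto intro: continuous_on_subset)
      ultimately show ?thesis unfolding strong_family_def by blast
    qed
    have K: "strong_family T (norm C * norm C) (memory_kernel L C)"
      by (rule strong_family_memory_kernel[OF assms(2) order_refl])
    have Kn: "strong_family T (norm C * norm C) (memory_kernel L (P N o\<^sub>L C))" for N
      by (rule strong_family_memory_kernel[OF assms(2) projC])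
    define x where "x = mild_solution T S (memory_kernel L C) F x0"
    define xn where "xn N = mild_solution T S (memory_kernel L (P N o\<^sub>L C)) F x0" for N
    have conv: "converges_in_C T xn x"
      unfolding x_def xn_def
    proof (rule mild_solution_convergence[OF SB K Kn T F])
      show "norm (memory_kernel L (P N o\<^sub>L C) t - memory_kernel L C t)
          \<le> norm C * norm ((id_blinfun - P N) o\<^sub>L C)" if "t \<in> {0..T}" for N t
        using diff that by simp
      show "(\<lambda>N. norm C * norm ((id_blinfun - P N) o\<^sub>L C)) \<longlonglongrightarrow> 0"
        by (rule tendsto_mult_right_zero[OF d0])
    qed
    \<comment> \<open>The defect is exactly the operator norm of \<open>C\<close> minus the reduced
      coupling, so the couplings converge in norm; the hidden states need this besides the
      convergence of the states.\<close>
    have "(\<lambda>N. P N o\<^sub>L C) \<longlonglongrightarrow> C"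
    proof -
      have "C - (P N o\<^sub>L C) = (id_blinfun - P N) o\<^sub>L C" for N
        by (rule blinfun_eqI) (simp add: blinfun.diff_left)
      then show ?thesis
        using d0 by (simp add: LIMSEQ_iff norm_minus_commute[of _ C])
    qed
    then have convq: "converges_in_C T (\<lambda>N. hidden_state L (P N o\<^sub>L C) (xn N)) (hidden_state L C x)"
      unfolding hidden_state_eq_kernel_conv
      by (intro kernel_conv_uniform_limit[OF strong_family_exp_op[OF assms(2)] T]
          converges_in_C_blinfun_apply conv)
    show "(\<forall>N. \<exists>!x. x \<in> extensional {0..T} \<and>
                 is_mild_solution T S (memory_kernel L (P N o\<^sub>L C)) F x0 x) \<and>
          (\<exists>!x. x \<in> extensional {0..T} \<and> is_mild_solution T S (memory_kernel L C) F x0 x) \<and>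
          converges_in_C T (\<lambda>N. mild_solution T S (memory_kernel L (P N o\<^sub>L C)) F x0)
            (mild_solution T S (memory_kernel L C) F x0) \<and>
          stable_reduction T S F x0 L C (\<lambda>N. L) (\<lambda>N. P N o\<^sub>L C)"
      unfolding stable_reduction_def Let_def x_def[symmetric] xn_def[symmetric]
      by (intro conjI allI mild_solution_unique_existence[OF SB K T F]
          mild_solution_unique_existence[OF SB Kn T F] conv convq assms(1,2) adj_works
          energy_dissipation_convergence[OF T])
  qed
  show "\<forall>N. finite_dim_subspace (range (blinfun_apply (P N))) \<and>
          blinfun_apply L ` range (blinfun_apply (P N)) \<subseteq> range (blinfun_apply (P N)) \<and>
          (\<forall>m ev Q. spectral_decomposition_on L (range (blinfun_apply (P N))) m ev Q \<longrightarrow>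
             (\<forall>t. memory_kernel L (P N o\<^sub>L C) t =
                (\<Sum>j=1..m. exp (- ev j * t) *\<^sub>R (adj (P N o\<^sub>L C) o\<^sub>L Q j o\<^sub>L (P N o\<^sub>L C)))) \<and>
             (\<forall>j\<in>{1..m}. selfadjoint (adj (P N o\<^sub>L C) o\<^sub>L Q j o\<^sub>L (P N o\<^sub>L C)) \<and>
                nonneg_op (adj (P N o\<^sub>L C) o\<^sub>L Q j o\<^sub>L (P N o\<^sub>L C))))"
  proof (intro allI conjI impI ballI)
    fix N
    show "finite_dim_subspace (range (blinfun_apply (P N)))" by (rule assms(4))
    have "blinfun_apply L (blinfun_apply (P N) v) = blinfun_apply (P N) (blinfun_apply L v)" for v
      using arg_cong[OF assms(6)[of N], of "\<lambda>A. blinfun_apply A v"] by simp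
    then show "blinfun_apply L ` range (blinfun_apply (P N)) \<subseteq> range (blinfun_apply (P N))" by auto
    fix m ev Q assume sd: "spectral_decomposition_on L (range (blinfun_apply (P N))) m ev Q"
    \<comment> \<open>The subspace is the range of \<open>P N\<close>, which contains the range of
      the reduced coupling.\<close>
    show "memory_kernel L (P N o\<^sub>L C) t =
        (\<Sum>j=1..m. exp (- ev j * t) *\<^sub>R (adj (P N o\<^sub>L C) o\<^sub>L Q j o\<^sub>L (P N o\<^sub>L C)))" for t
      by (rule memory_kernel_spectral[OF assms(1) sd subspace_range_blinfun]) auto
    fix j assume "j \<in> {1..m}"
    then have Q: "orth_projection (Q j)" using sd by (simp add: spectral_decomposition_on_def)
    then show "selfadjoint (adj (P N o\<^sub>L C) o\<^sub>L Q j o\<^sub>L (P N o\<^sub>L C))"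
      by (intro selfadjoint_conjugation) (simp add: orth_projection_def)
    show "nonneg_op (adj (P N o\<^sub>L C) o\<^sub>L Q j o\<^sub>L (P N o\<^sub>L C))"
      by (intro nonneg_op_conjugation nonneg_op_orth_projection Q)
  qed
qed

end
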